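(* Let $\sigma$ be any connected skew shape, with $n$ boxes and $k$ rows. Then the expected number of turns in a staircase path in $\sigma$ chosen according to the probability distribution $\mu_{BN}$ is $$E_\sigma=2\left(k+\sum_{i=1}^{k}\frac{k-i}{n+1}\cdot\frac{f^{{}^i\sigma}}{f^\sigma}-\sum_{i=1}^{k}\frac{k+1-i}{n+1}\cdot\frac{f^{\sigma^i}}{f^\sigma}\right).$$ Moreover, the number of edges in the graph $BN(\sigma)$ is $$k(n+1)f^\sigma+\sum_{i=1}^{k}(k-i)\, f^{{}^i\sigma}-\sum_{i=1}^{k}(k+1-i)\, f^{\sigma^i}.$$
   Context: For partitions $\lambda=(\lambda_1\ge\cdots\ge\lambda_k>0)$ and $\mu$ with $\mu_i\le\lambda_i$ for all $i$ (missing parts are $0$), the skew shape $\sigma=\lambda\setminus\mu$ consists of the boxes $(i,j)$ (row $i$ from the top, column $j$ from the left) with $\mu_i<j\le\lambda_i$; it has $k$ rows. A skew shape is connected if its lower left and upper right corners are joined by a walk along the edges of its boxes. $sSYT(\sigma)$ is the set of skew standard Young tableaux of shape $\sigma$: bijective fillings of the $n$ boxes with $1,\ldots,n$, strictly increasing along rows and columns; $f^\sigma=|sSYT(\sigma)|$. $\sigma^i$ (resp. ${}^i\sigma$) denotes the shape obtained by adding a box to row $i$ on the right (resp. on the left) if the result is again a skew shape; otherwise $f^{\sigma^i}=0$ (resp. $f^{{}^i\sigma}=0$). Explicitly $\sigma^i$ is a skew shape iff $i=1$ or $\lambda_i<\lambda_{i-1}$; ${}^i\sigma$ is a skew shape iff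 $i=k$ (translating the shape if necessary) or $\mu_i>\mu_{i+1}$. Brill-Noether graph $BN(\sigma)$: its vertices are the almost-standard skew Young tableaux (aSYT) of shape $\sigma$, i.e. injective fillings of the $n$ boxes with numbers from $\{1,\ldots,n+1\}$ strictly increasing along rows and columns; two are adjacent if they differ in exactly one box. A staircase path in a connected skew shape $\sigma$ is a path along box edges in $\sigma$ from the lower left corner to the upper right corner of $\sigma$ using only right-steps and up-steps. A turn is a consecutive pair of steps (right, up) or (up, right) such that both steps border a common box of $\sigma$. For $T\in sSYT(\sigma)$ and $m\in\{1,\ldots,n+1\}$, $s(T,m)$ is the unique staircase path dividing the entries $<m$ of $T$ from the entries $\ge m$ (the former lying to the northwest). $\mu_{BN}$ is the distribution of $s(T,m)$ when $T\in sSYT(\sigma)$ and $m\in\{1,\ldots,n+1\}$ are chosen independently and uniformly at random, and $E_\sigma$ is the expected number of turns of a path chosen according to $\mu_{BN}$. *)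

theory Defs
  imports "HOL-Probability.Probability"
begin

text \<open>Parts are indexed from 1, and missing parts are 0.\<close>

definition is_partition :: "nat list \<Rightarrow> bool" where
  "is_partition xs \<longleftrightarrow> sorted_wrt (\<ge>) xs \<and> (\<forall>x\<in>set xs. 0 < x)"

definition part :: "nat list \<Rightarrow> nat \<Rightarrow> nat" where
  "part xs i = (if 1 \<le> i \<and> i \<le> length xs then xs ! (i - 1) else 0)"

definition skew_pair :: "nat list \<Rightarrow> nat list \<Rightarrow> bool" where
  "skew_pair lam mu \<longleftrightarrow>
     is_partition lam \<and> is_partition mu \<and> (\<forall>i\<ge>1. part mu i \<le> part lam i)"

type_synonym box = "nat \<times> nat"
type_synonym vertex = "nat \<times> nat"
type_synonym filling = "box \<Rightarrow> nat"

definition skew_boxes :: "nat list \<Rightarrow> nat list \<Rightarrow> box set" where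
  "skew_boxes lam mu =
     {(i, j). 1 \<le> i \<and> i \<le> length lam \<and> part mu i < j \<and> j \<le> part lam i}"

text \<open>
  A set of boxes is a skew shape if some translate of it to the right is the diagram of a pair
  of partitions. The translation matters only for sets with a box in column 0, which arise
  when a box is added on the left of a bottom row starting in column 1.
\<close>

definition is_skew_shape :: "box set \<Rightarrow> bool" where
  "is_skew_shape S \<longleftrightarrow>
     (\<exists>lam mu c. skew_pair lam mu \<and> (\<lambda>(i, j). (i, j + c)) ` S = skew_boxes lam mu)"

definition increasing_on :: "box set \<Rightarrow> filling \<Rightarrow> bool" where
  "increasing_on S T \<longleftrightarrow>
     (\<forall>i j j'. (i, j) \<in> S \<longrightarrow> (i, j') \<in> S \<longrightarrow> j < j' \<longrightarrow> T (i, j) < T (i, j')) \<and>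
     (\<forall>i i' j. (i, j) \<in> S \<longrightarrow> (i', j) \<in> S \<longrightarrow> i < i' \<longrightarrow> T (i, j) < T (i', j))"

text \<open>Fillings are extensional, so that each tableau is represented by exactly one function.\<close>

definition sSYT :: "box set \<Rightarrow> filling set" where
  "sSYT S = {T \<in> extensional S. bij_betw T S {1..card S} \<and> increasing_on S T}"

definition aSYT :: "box set \<Rightarrow> filling set" where
  "aSYT S = {T \<in> extensional S. inj_on T S \<and> T ` S \<subseteq> {1..card S + 1} \<and> increasing_on S T}"

definition num_SYT :: "box set \<Rightarrow> nat" where
  "num_SYT S = card (sSYT S)"

definition num_SYT_right :: "nat list \<Rightarrow> nat list \<Rightarrow> nat \<Rightarrow> nat" where
  "num_SYT_right lam mu i =
     (let S = insert (i, part lam i + 1) (skew_boxes lam mu)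
      in if is_skew_shape S then num_SYT S else 0)"

definition num_SYT_left :: "nat list \<Rightarrow> nat list \<Rightarrow> nat \<Rightarrow> nat" where
  "num_SYT_left lam mu i =
     (let S = insert (i, part mu i) (skew_boxes lam mu)
      in if is_skew_shape S then num_SYT S else 0)"

text \<open>The Brill--Noether graph has vertex set \<open>aSYT S\<close> and the following edges.\<close>

definition BN_edges :: "box set \<Rightarrow> filling set set" where
  "BN_edges S =
     {{T, T'} | T T'. T \<in> aSYT S \<and> T' \<in> aSYT S \<and> card {b \<in> S. T b \<noteq> T' b} = 1}"

text \<open>
  The vertex \<open>(r, c)\<close> is the lattice point \<open>r\<close> units below and \<open>c\<close> units to the right of the
  upper left corner of box \<open>(1, 1)\<close>; thus box \<open>(i, j)\<close> has lower right corner \<open>(i, j)\<close>.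
  The subtractions below are exact on diagrams, whose boxes have positive coordinates.
\<close>

fun box_edges :: "box \<Rightarrow> vertex set set" where
  "box_edges (i, j) =
     {{(i - 1, j - 1), (i - 1, j)}, {(i, j - 1), (i, j)},
      {(i - 1, j - 1), (i, j - 1)}, {(i - 1, j), (i, j)}}"

definition lower_left :: "nat list \<Rightarrow> nat list \<Rightarrow> vertex" where
  "lower_left lam mu = (length lam, part mu (length lam))"

definition upper_right :: "nat list \<Rightarrow> vertex" where
  "upper_right lam = (0, part lam 1)"

text \<open>
  Walks and paths are given by their lists of vertices. In this notion of connectedness two
  boxes may meet in just a corner, but no row of a connected shape is empty.
\<close>

definition edge_walk :: "nat list \<Rightarrow> nat list \<Rightarrow> vertex list \<Rightarrow> bool" where
  "edge_walk lam mu p \<longleftrightarrow>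
     p \<noteq> [] \<and> hd p = lower_left lam mu \<and> last p = upper_right lam \<and>
     successively (\<lambda>u v. \<exists>b\<in>skew_boxes lam mu. {u, v} \<in> box_edges b) p"

definition skew_connected :: "nat list \<Rightarrow> nat list \<Rightarrow> bool" where
  "skew_connected lam mu \<longleftrightarrow> (\<exists>p. edge_walk lam mu p)"

definition right_step :: "vertex \<Rightarrow> vertex \<Rightarrow> bool" where
  "right_step u v \<longleftrightarrow> fst v = fst u \<and> snd v = snd u + 1"

definition up_step :: "vertex \<Rightarrow> vertex \<Rightarrow> bool" where
  "up_step u v \<longleftrightarrow> fst u = fst v + 1 \<and> snd v = snd u"

definition staircase_paths :: "nat list \<Rightarrow> nat list \<Rightarrow> vertex list set" where
  "staircase_paths lam mu =
     {p. edge_walk lam mu p \<and> successively (\<lambda>u v. right_step u v \<or> up_step u v) p}"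

definition is_turn :: "box set \<Rightarrow> vertex \<Rightarrow> vertex \<Rightarrow> vertex \<Rightarrow> bool" where
  "is_turn S u v w \<longleftrightarrow>
     (right_step u v \<and> up_step v w \<or> up_step u v \<and> right_step v w) \<and>
     (\<exists>b\<in>S. {u, v} \<in> box_edges b \<and> {v, w} \<in> box_edges b)"

definition turns :: "box set \<Rightarrow> vertex list \<Rightarrow> nat" where
  "turns S p = card {t. t + 2 < length p \<and> is_turn S (p ! t) (p ! (t + 1)) (p ! (t + 2))}"

text \<open>
  A box lies to the northwest of a staircase path if its lower right corner lies weakly above
  and weakly to the left of some vertex of the path.
\<close>

definition northwest :: "vertex list \<Rightarrow> box \<Rightarrow> bool" where
  "northwest p b \<longleftrightarrow> (\<exists>v\<in>set p. fst b \<le> fst v \<and> snd b \<le> snd v)"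

definition dividing_path :: "nat list \<Rightarrow> nat list \<Rightarrow> filling \<Rightarrow> nat \<Rightarrow> vertex list" where
  "dividing_path lam mu T m =
     (THE p. p \<in> staircase_paths lam mu \<and>
             (\<forall>b\<in>skew_boxes lam mu. (T b < m \<longrightarrow> northwest p b) \<and> (T b \<ge> m \<longrightarrow> \<not> northwest p b)))"

definition mu_BN :: "nat list \<Rightarrow> nat list \<Rightarrow> vertex list pmf" where
  "mu_BN lam mu =
     map_pmf (\<lambda>(T, m). dividing_path lam mu T m)
       (pair_pmf (pmf_of_set (sSYT (skew_boxes lam mu)))
                 (pmf_of_set {1..card (skew_boxes lam mu) + 1}))"

definition expected_turns :: "nat list \<Rightarrow> nat list \<Rightarrow> real" where
  "expected_turns lam mu =
     measure_pmf.expectation (mu_BN lam mu) (\<lambda>p. real (turns (skew_boxes lam mu) p))"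

end

theory Submission
  imports Defs
begin

text \<open>
  An almost-standard tableau \<open>U\<close> amounts to a pair of a standard tableau and the value \<open>m\<close> that \<open>U\<close>
  misses; its neighbours are obtained by changing an entry to \<open>m\<close>, and the boxes where this is
  possible are the turns of the staircase path between the entries below and above \<open>m\<close>. Hence the
  expected number of turns is twice the number of edges divided by the number of vertices.

  Let \<open>a\<^sub>i\<close> be the last column of row \<open>i\<close> with an entry below \<open>m\<close>, and let \<open>x\<^sub>i\<close> be the number of \<open>U\<close>
  with \<open>i = 1\<close> or \<open>a\<^sub>i < a\<^sub>i\<^sub>-\<^sub>1\<close>. Among the \<open>U\<close> counted by \<open>x\<^sub>i\<close>, those with \<open>a\<^sub>i < \<lambda>\<^sub>i\<close> can lower an entry
  of row \<open>i\<close>, and those with \<open>a\<^sub>i = \<lambda>\<^sub>i\<close> extend to standard tableaux with a further box at the right of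
  row \<open>i\<close>. Among those counted by \<open>x\<^sub>i\<^sub>+\<^sub>1\<close>, the ones with \<open>a\<^sub>i > \<mu>\<^sub>i\<close> can raise an entry of row \<open>i\<close>, and
  those with \<open>a\<^sub>i = \<mu>\<^sub>i\<close> extend by a box at the left. Every edge is a raise seen from one end and a lowering
  seen from the other, so \<open>x\<^sub>i\<^sub>+\<^sub>1 - x\<^sub>i\<close> is the difference of the two numbers of extensions, and
  the edge count telescopes from \<open>x\<^sub>1\<close>, the number of vertices.
\<close>

section \<open>Almost-standard tableaux and the Brill--Noether graph\<close>

definition missing :: "box set \<Rightarrow> filling \<Rightarrow> nat" where
  "missing S U = (THE m. m \<in> {1..card S + 1} - U ` S)"

text \<open>An injective filling uses \<open>card S\<close> of the \<open>card S + 1\<close>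
  available values, so exactly one is left over and the definite description is meaningful.\<close>

lemma missing_props:
  assumes "finite S" "U \<in> aSYT S"
  shows missing_in: "missing S U \<in> {1..card S + 1}"
    and missing_notin: "missing S U \<notin> U ` S"
    and missing_unique: "m \<in> {1..card S + 1} \<Longrightarrow> m \<notin> U ` S \<Longrightarrow> missing S U = m"
proof -
  have "card ({1..card S + 1} - U ` S) = 1"
    using assms by (subst card_Diff_subset) (auto simp: aSYT_def card_image)
  then obtain x where x: "{1..card S + 1} - U ` S = {x}"
    by (auto simp: card_1_singleton_iff)
  then have "missing S U = x"
    unfolding missing_def by simp
  with x have eq: "{1..card S + 1} - U ` S = {missing S U}"
    by simp
  from eq show "missing S U \<in> {1..card S + 1}" by blast
  from eq show "missing S U \<notin> U ` S" by blast
  from eq show "m \<in> {1..card S + 1} \<Longrightarrow> m \<notin> U ` S \<Longrightarrow> missing S U = m"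
    by (metis DiffI singletonD)
qed

text \<open>All values except the missing one are taken, so a neighbour of \<open>U\<close> that
  differs from it at \<open>b\<close> must carry \<open>missing S U\<close> there. Movable boxes
  thus correspond to neighbours of \<open>U\<close>.\<close>

definition movable :: "box set \<Rightarrow> filling \<Rightarrow> box \<Rightarrow> bool" where
  "movable S U b \<longleftrightarrow> b \<in> S \<and> U(b := missing S U) \<in> aSYT S"

lemma movable_iff:
  assumes "finite S" "U \<in> aSYT S" "b \<in> S"
  shows "movable S U b \<longleftrightarrow> increasing_on S (U(b := missing S U))"
  using assms missing_in[OF assms(1,2)] missing_notin[OF assms(1,2)]
  by (auto simp: movable_def aSYT_def inj_on_fun_updI extensional_def)

lemma missing_move:
  assumes "finite S" "U \<in> aSYT S" "movable S U b"
  shows "missing S (U(b := missing S U)) = U b"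
proof (rule missing_unique)
  have b: "b \<in> S" "U(b := missing S U) \<in> aSYT S"
    using assms by (auto simp: movable_def)
  then show "U(b := missing S U) \<in> aSYT S" by simp
  show "U b \<in> {1..card S + 1}"
    using assms b by (auto simp: aSYT_def)
  show "U b \<notin> (U(b := missing S U)) ` S"
  proof
    assume "U b \<in> (U(b := missing S U)) ` S"
    then obtain c where c: "c \<in> S" "U b = (U(b := missing S U)) c" by blast
    have ne: "missing S U \<noteq> U b" using missing_notin[OF assms(1,2)] b by blast
    then have "c \<noteq> b" using c by auto
    then have "U b = U c" using c by simp
    moreover have "inj_on U S" using assms(2) by (simp add: aSYT_def)
    ultimately show False using \<open>c \<noteq> b\<close> c b by (metis inj_onD)
  qed
qed (fact assms)

text \<open>Low and high describe the entry before the move: a low move raises it past the missing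
  value, a high move lowers it.\<close>

definition low_moves :: "box set \<Rightarrow> (filling \<times> box) set" where
  "low_moves S = {(U, b). U \<in> aSYT S \<and> movable S U b \<and> U b < missing S U}"

definition high_moves :: "box set \<Rightarrow> (filling \<times> box) set" where
  "high_moves S = {(U, b). U \<in> aSYT S \<and> movable S U b \<and> missing S U < U b}"

text \<open>A move exchanges the entry with the missing value, so repeating it at the same box
  undoes it.\<close>

lemma move_back:
  assumes "finite S" "U \<in> aSYT S" "movable S U b"
  defines "W \<equiv> U(b := missing S U)"
  shows "W \<in> aSYT S" "movable S W b" "missing S W = U b" "W b = missing S U"
    "W(b := missing S W) = U"
proof -
  show "W \<in> aSYT S" using assms by (simp add: movable_def)
  show "missing S W = U b" unfolding W_def by (rule missing_move) fact+
  then show "W(b := missing S W) = U" by (simp add: W_def)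
  then show "movable S W b" using assms by (simp add: movable_def)
qed (simp add: W_def)

text \<open>Moving is an involution that turns low moves into high moves and keeps the box; the
  predicate \<open>P\<close> on boxes allows a comparison row by row.\<close>

lemma card_low_eq_high:
  assumes "finite S"
  shows "card {x \<in> low_moves S. P (snd x)} = card {x \<in> high_moves S. P (snd x)}"
proof (rule bij_betw_same_card)
  let ?f = "\<lambda>x. ((fst x)(snd x := missing S (fst x)), snd x)"
  show "bij_betw ?f {x \<in> low_moves S. P (snd x)} {x \<in> high_moves S. P (snd x)}"
  proof (rule bij_betw_byWitness[where f' = ?f])
    show "\<forall>x\<in>{x \<in> low_moves S. P (snd x)}. ?f (?f x) = x"
      and "\<forall>x\<in>{x \<in> high_moves S. P (snd x)}. ?f (?f x) = x"
      unfolding low_moves_def high_moves_def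
      by (auto simp del: fun_upd_apply simp: move_back[OF assms])
    show "?f ` {x \<in> low_moves S. P (snd x)} \<subseteq> {x \<in> high_moves S. P (snd x)}"
      and "?f ` {x \<in> high_moves S. P (snd x)} \<subseteq> {x \<in> low_moves S. P (snd x)}"
      unfolding low_moves_def high_moves_def
      by (auto simp del: fun_upd_apply simp: move_back[OF assms])
  qed
qed

lemma finite_aSYT:
  assumes "finite S"
  shows "finite (aSYT S)"
proof (rule finite_subset)
  show "aSYT S \<subseteq> (S \<rightarrow>\<^sub>E {1..card S + 1})"
    by (auto simp: aSYT_def PiE_def)
qed (simp add: assms finite_PiE)

lemma finite_moves:
  assumes "finite S"
  shows "finite (low_moves S)" "finite (high_moves S)"
proof -
  have "low_moves S \<subseteq> aSYT S \<times> S" "high_moves S \<subseteq> aSYT S \<times> S"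
    by (auto simp: low_moves_def high_moves_def movable_def)
  then show "finite (low_moves S)" "finite (high_moves S)"
    using finite_aSYT[OF assms] assms by (meson finite_SigmaI finite_subset)+
qed

text \<open>An edge is listed once, from its endpoint with the smaller entry in the box that differs.\<close>

lemma card_BN_edges:
  assumes "finite S"
  shows "card (BN_edges S) = card (low_moves S)"
proof -
  let ?f = "\<lambda>(U, b). {U, U(b := missing S U)}"
  have "bij_betw ?f (low_moves S) (BN_edges S)"
  proof (rule bij_betw_imageI)
    show "inj_on ?f (low_moves S)"
    proof (rule inj_onI, clarify)
      fix U b W c
      assume U: "(U, b) \<in> low_moves S" and W: "(W, c) \<in> low_moves S"
        and eq: "{U, U(b := missing S U)} = {W, W(c := missing S W)}"
      have 1: "U b < missing S U" "W c < missing S W"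
        using U W by (auto simp: low_moves_def)
      from eq have "U = W \<and> U(b := missing S U) = W(c := missing S W)
          \<or> U = W(c := missing S W) \<and> U(b := missing S U) = W"
        by (simp only: doubleton_eq_iff)
      then show "U = W \<and> b = c"
      proof
        assume *: "U = W \<and> U(b := missing S U) = W(c := missing S W)"
        then have "(U(b := missing S U)) b = (U(c := missing S U)) b" by metis
        with 1 * show ?thesis by (auto split: if_splits)
      next
        \<comment> \<open>If the endpoints were exchanged, each would have the smaller entry in the
          box that differs, which is impossible.\<close>
        assume *: "U = W(c := missing S W) \<and> U(b := missing S U) = W"
        then have "U b = (W(c := missing S W)) b" "(U(b := missing S U)) b = W b" by metis+
        with 1 show ?thesis by (auto split: if_splits)
      qed
    qed
    show "?f ` low_moves S = BN_edges S"
    proof (intro equalityI subsetI)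
      fix e assume "e \<in> ?f ` low_moves S"
      then obtain U b where e: "e = {U, U(b := missing S U)}" and Ub: "(U, b) \<in> low_moves S"
        by auto
      have "{x \<in> S. U x \<noteq> (U(b := missing S U)) x} = {b}"
        using Ub by (auto simp: low_moves_def movable_def)
      then have "card {x \<in> S. U x \<noteq> (U(b := missing S U)) x} = 1"
        by simp
      then show "e \<in> BN_edges S"
        using Ub e unfolding BN_edges_def low_moves_def movable_def by blast
    next
      have key: "{U, W} \<in> ?f ` low_moves S"
        if "U \<in> aSYT S" "W \<in> aSYT S" "{x \<in> S. U x \<noteq> W x} = {b}" "U b < W b" for U W b
      proof -
        have b: "b \<in> S" using that(3) by blast
        have eq: "U x = W x" if "x \<in> S" "x \<noteq> b" for x
          using that \<open>{x \<in> S. U x \<noteq> W x} = {b}\<close> by blast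
        \<comment> \<open>Outside \<open>S\<close> both fillings take the default value of
          extensional functions, so agreement on the other boxes gives equality of
          functions.\<close>
        have W: "U(b := W b) = W"
        proof
          fix x
          show "(U(b := W b)) x = W x"
            using eq[of x] b that(1,2)
            by (cases "x \<in> S") (auto simp: aSYT_def extensional_arb[of _ S])
        qed
        have "W b \<notin> U ` S"
        proof
          assume "W b \<in> U ` S"
          then obtain c where c: "c \<in> S" "W b = U c" by auto
          then have "c \<noteq> b" using that(4) by auto
          then have "W c = W b" using c eq by simp
          moreover have "inj_on W S" using that(2) by (simp add: aSYT_def)
          ultimately show False using \<open>c \<noteq> b\<close> c b by (metis inj_onD)
        qed
        moreover have "W b \<in> {1..card S + 1}"
          using that b by (auto simp: aSYT_def)
        ultimately have m: "missing S U = W b"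
          using missing_unique[OF assms that(1)] by blast
        have "movable S U b" unfolding movable_def m W using b that(2) by blast
        then have "(U, b) \<in> low_moves S"
          using that(1,4) m by (simp add: low_moves_def)
        moreover have "{U, W} = ?f (U, b)" unfolding prod.case m W ..
        ultimately show ?thesis by (rule rev_image_eqI)
      qed
      fix e assume "e \<in> BN_edges S"
      then obtain U W where e: "e = {U, W}" "U \<in> aSYT S" "W \<in> aSYT S"
        and "card {b \<in> S. U b \<noteq> W b} = 1"
        unfolding BN_edges_def by blast
      then obtain b where b: "{x \<in> S. U x \<noteq> W x} = {b}"
        by (auto simp: card_1_singleton_iff)
      then have b': "{x \<in> S. W x \<noteq> U x} = {b}"
        by (intro trans[OF Collect_cong b]) metis
      have "b \<in> {x \<in> S. U x \<noteq> W x}" unfolding b by simp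
      then have "U b < W b \<or> W b < U b" by auto
      then show "e \<in> ?f ` low_moves S"
        using key[OF e(2,3) b] key[OF e(3,2) b'] e(1) by (metis insert_commute)
    qed
  qed
  then show ?thesis by (simp add: bij_betw_same_card)
qed

section \<open>Standard tableaux with a chosen gap value\<close>

definition open_gap :: "box set \<Rightarrow> filling \<Rightarrow> nat \<Rightarrow> filling" where
  "open_gap S T m = restrict (\<lambda>b. if T b < m then T b else T b + 1) S"

definition close_gap :: "box set \<Rightarrow> filling \<Rightarrow> filling" where
  "close_gap S U = restrict (\<lambda>b. if U b < missing S U then U b else U b - 1) S"

lemma open_gap_less_iff: "b \<in> S \<Longrightarrow> open_gap S T m b < m \<longleftrightarrow> T b < m"
  by (auto simp: open_gap_def)

lemma open_gap_aSYT:
  assumes "T \<in> sSYT S"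
  shows "open_gap S T m \<in> aSYT S"
proof -
  have 1: "inj_on T S" "T ` S = {1..card S}" "increasing_on S T"
    using assms by (auto simp: sSYT_def bij_betw_def)
  have "T b \<in> {1..card S}" if "b \<in> S" for b using that 1 by blast
  then have "open_gap S T m ` S \<subseteq> {1..card S + 1}"
    by (force simp: open_gap_def)
  moreover have "inj_on (open_gap S T m) S"
    using 1(1) by (auto simp: open_gap_def inj_on_def split: if_splits)
  moreover have "increasing_on S (open_gap S T m)"
    using 1(3) by (fastforce simp: open_gap_def increasing_on_def)
  ultimately show ?thesis by (auto simp: aSYT_def open_gap_def)
qed

lemma missing_open_gap:
  assumes "finite S" "T \<in> sSYT S" "m \<in> {1..card S + 1}"
  shows "missing S (open_gap S T m) = m"
  using assms by (intro missing_unique open_gap_aSYT) (auto simp: open_gap_def)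

lemma close_gap_sSYT:
  assumes "finite S" "U \<in> aSYT S"
  shows "close_gap S U \<in> sSYT S"
proof -
  let ?m = "missing S U"
  note m = missing_in[OF assms] missing_notin[OF assms]
  have U: "inj_on U S" "U ` S \<subseteq> {1..card S + 1}" "increasing_on S U"
    using assms by (auto simp: aSYT_def)
  have ne: "U b \<noteq> ?m" if "b \<in> S" for b using m(2) that by (metis imageI)
  have rng: "U b \<in> {1..card S + 1}" if "b \<in> S" for b using U that by auto
  \<comment> \<open>No entry equals \<open>?m\<close>, so two entries on either side of it differ by
    at least 2 and stay distinct after the upper one drops by 1.\<close>
  have strict: "close_gap S U b < close_gap S U c" if "b \<in> S" "c \<in> S" "U b < U c" for b c
    using ne[OF that(1)] ne[OF that(2)] that by (auto simp: close_gap_def)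
  have inj: "inj_on (close_gap S U) S"
  proof (rule inj_onI)
    fix x y assume "x \<in> S" "y \<in> S" "close_gap S U x = close_gap S U y"
    then have "U x = U y" using strict[of x y] strict[of y x] by (metis linorder_neqE_nat less_irrefl)
    then show "x = y" using U \<open>x \<in> S\<close> \<open>y \<in> S\<close> by (metis inj_onD)
  qed
  have "close_gap S U b \<in> {1..card S}" if "b \<in> S" for b
    using ne[OF that] rng[OF that] m(1) that by (auto simp: close_gap_def)
  then have "close_gap S U ` S \<subseteq> {1..card S}" by blast
  then have "close_gap S U ` S = {1..card S}"
    using inj by (intro card_subset_eq) (auto simp: card_image)
  moreover have "increasing_on S (close_gap S U)"
    using U(3) strict by (auto simp: increasing_on_def)
  ultimately show ?thesis using inj
    by (auto simp: sSYT_def bij_betw_def close_gap_def)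
qed

text \<open>This carries the uniform pairs \<open>(T, m)\<close> behind \<open>mu_BN\<close> to the
  vertices of the graph. It serves both to count the vertices and to rewrite the
  expectation.\<close>

lemma bij_open_gap:
  assumes "finite S"
  shows "bij_betw (\<lambda>(T, m). open_gap S T m) (sSYT S \<times> {1..card S + 1}) (aSYT S)"
proof (rule bij_betw_byWitness[where f' = "\<lambda>U. (close_gap S U, missing S U)"])
  have "close_gap S (open_gap S T m) = T"
    if "T \<in> sSYT S" "m \<in> {1..card S + 1}" for T m
  proof
    fix b
    show "close_gap S (open_gap S T m) b = T b"
      using that missing_open_gap[OF assms that]
      by (cases "b \<in> S")
        (auto simp: close_gap_def open_gap_def sSYT_def extensional_arb[of T S])
  qed
  then show "\<forall>a\<in>sSYT S \<times> {1..card S + 1}.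
      (close_gap S (case a of (T, m) \<Rightarrow> open_gap S T m),
       missing S (case a of (T, m) \<Rightarrow> open_gap S T m)) = a"
    using assms by (auto simp: missing_open_gap)
  have "open_gap S (close_gap S U) (missing S U) = U" if U: "U \<in> aSYT S" for U
  proof
    fix b
    show "open_gap S (close_gap S U) (missing S U) b = U b"
    proof (cases "b \<in> S")
      case True
      then have "U b \<noteq> missing S U" using missing_notin[OF assms U] by (metis imageI)
      then show ?thesis using True by (auto simp: close_gap_def open_gap_def)
    next
      case False
      then show ?thesis
        using U by (simp add: open_gap_def aSYT_def extensional_arb[of U S])
    qed
  qed
  then show "\<forall>a'\<in>aSYT S. (case (close_gap S a', missing S a') of (T, m) \<Rightarrow> open_gap S T m) = a'"
    by simp
  show "(\<lambda>(T, m). open_gap S T m) ` (sSYT S \<times> {1..card S + 1}) \<subseteq> aSYT S"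
    by (auto simp: open_gap_aSYT)
  show "(\<lambda>U. (close_gap S U, missing S U)) ` aSYT S \<subseteq> sSYT S \<times> {1..card S + 1}"
    using close_gap_sSYT[OF assms] missing_in[OF assms] by auto
qed

lemma card_aSYT:
  assumes "finite S"
  shows "card (aSYT S) = (card S + 1) * num_SYT S"
  using bij_betw_same_card[OF bij_open_gap[OF assms]]
  by (simp add: num_SYT_def card_cartesian_product algebra_simps)

lemma finite_sSYT:
  assumes "finite S"
  shows "finite (sSYT S)"
proof (rule finite_subset)
  show "sSYT S \<subseteq> (S \<rightarrow>\<^sub>E {1..card S})"
    by (auto simp: sSYT_def PiE_def bij_betw_def)
qed (simp add: assms finite_PiE)

text \<open>Boxes are added in order of \<open>i + j\<close>. The new box maximises this sum, so no
  earlier box lies to its right in its row or below it in its column, and it can take the largest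
  entry.\<close>

lemma sSYT_nonempty:
  assumes "finite S"
  shows "sSYT S \<noteq> {}"
  using assms
proof (induction rule: finite_ranking_induct[where f = "\<lambda>(i, j). i + j :: nat"])
  case empty
  have "(\<lambda>_. undefined) \<in> sSYT {}" by (simp add: sSYT_def increasing_on_def bij_betw_def)
  then show ?case by blast
next
  case (insert b S)
  show ?case
  proof (cases "b \<in> S")
    case True
    then show ?thesis using insert by (simp add: insert_absorb)
  next
    case False
    obtain T where T: "T \<in> sSYT S" using insert by auto
    then have bij: "bij_betw T S {1..card S}" and inc: "increasing_on S T"
      by (auto simp: sSYT_def)
    let ?T = "T(b := card S + 1)"
    have less: "T c < card S + 1" if "c \<in> S" for c
      using bij_betwE[OF bij] that by fastforce
    have "bij_betw ?T S {1..card S}"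
      using bij False by (subst bij_betw_cong[where g = T]) auto
    then have "bij_betw ?T (insert b S) {1..card (insert b S)}"
      using notIn_Un_bij_betw[of b S ?T "{1..card S}"] insert(1) False
      by (simp add: atLeastAtMostSuc_conv)
    moreover have "increasing_on (insert b S) ?T"
      using inc less insert(2) False by (cases b) (fastforce simp: increasing_on_def)
    ultimately have "?T \<in> sSYT (insert b S)"
      using T by (auto simp: sSYT_def extensional_def)
    then show ?thesis by blast
  qed
qed

text \<open>A standard tableau on \<open>insert b S\<close> restricts to an almost-standard one on
  \<open>S\<close> whose missing value is the entry at \<open>b\<close>, so the restriction loses
  nothing.\<close>

lemma num_SYT_insert:
  assumes "finite S" "b \<notin> S"
  shows "num_SYT (insert b S) =
    card {U \<in> aSYT S. increasing_on (insert b S) (U(b := missing S U))}"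
  unfolding num_SYT_def
proof (rule bij_betw_same_card)
  let ?A = "{U \<in> aSYT S. increasing_on (insert b S) (U(b := missing S U))}"
  have cS: "card (insert b S) = card S + 1" using assms by simp
  have 1: "restrict T S \<in> aSYT S \<and> (restrict T S)(b := missing S (restrict T S)) = T"
    if T: "T \<in> sSYT (insert b S)" for T
  proof -
    have bij: "bij_betw T (insert b S) {1..card S + 1}" and "increasing_on (insert b S) T"
      and ext: "T \<in> extensional (insert b S)"
      using T cS by (auto simp: sSYT_def)
    then have a: "restrict T S \<in> aSYT S"
      by (auto simp: aSYT_def bij_betw_def increasing_on_def)
    have "T b \<notin> T ` S"
      using bij assms(2) by (simp add: bij_betw_def)
    then have "missing S (restrict T S) = T b"
      using bij assms by (intro missing_unique a) (auto simp: bij_betw_def)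
    then have "(restrict T S)(b := missing S (restrict T S)) = T"
      using ext by (auto simp: extensional_def fun_eq_iff)
    with a show ?thesis by blast
  qed
  show "bij_betw (\<lambda>T. restrict T S) (sSYT (insert b S)) ?A"
  proof (rule bij_betw_byWitness[where f' = "\<lambda>U. U(b := missing S U)"])
    show "\<forall>a\<in>sSYT (insert b S). (restrict a S)(b := missing S (restrict a S)) = a"
      using 1 by blast
    show "\<forall>a'\<in>?A. restrict (a'(b := missing S a')) S = a'"
      using assms by (auto simp: aSYT_def extensional_def fun_eq_iff)
    show "(\<lambda>T. restrict T S) ` sSYT (insert b S) \<subseteq> ?A"
      using 1 by (auto simp: sSYT_def)
    show "(\<lambda>U. U(b := missing S U)) ` ?A \<subseteq> sSYT (insert b S)"
    proof clarify
      fix U assume U: "U \<in> aSYT S" and inc: "increasing_on (insert b S) (U(b := missing S U))"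
      let ?T = "U(b := missing S U)"
      have img: "?T ` S = U ` S" using assms(2) by (intro image_cong) auto
      then have inj: "inj_on ?T (insert b S)"
        using U assms missing_notin[OF assms(1) U]
        by (auto simp: aSYT_def inj_on_fun_updI simp del: fun_upd_apply fun_upd_image)
          (simp add: assms(2))
      have "?T ` insert b S \<subseteq> {1..card S + 1}"
        using U missing_in[OF assms(1) U] img
        unfolding image_insert by (simp add: aSYT_def del: fun_upd_image)
      then have "?T ` insert b S = {1..card S + 1}"
        using cS card_image[OF inj]
        by (intro card_subset_eq) (simp_all del: fun_upd_image image_insert)
      then show "?T \<in> sSYT (insert b S)"
        using U inj inc cS by (auto simp: sSYT_def aSYT_def bij_betw_def extensional_def)
    qed
  qed
qed

section \<open>Skew shapes and the number of small entries in each row\<close>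

lemma part_antimono:
  assumes "is_partition xs" "1 \<le> i" "i \<le> j"
  shows "part xs j \<le> part xs i"
proof (cases "i < j \<and> j \<le> length xs")
  case True
  then have "xs ! (i - 1) \<ge> xs ! (j - 1)"
    using assms by (auto simp: is_partition_def sorted_wrt_iff_nth_less)
  then show ?thesis using True assms by (simp add: part_def)
qed (use assms in \<open>auto simp: part_def\<close>)

section \<open>Restrictions that connectedness places on the rows\<close>

lemma successively_invariant:
  assumes "successively P xs" "xs \<noteq> []" "Q (hd xs)" "\<And>u v. P u v \<Longrightarrow> Q u \<Longrightarrow> Q v"
  shows "Q (last xs)"
  using assms(1-3)
proof (induction xs rule: induct_list012)
  case (3 x y zs)
  then show ?case using assms(4)[of x y] by simp
qed auto

lemma box_edges_bounds:
  assumes "{u, v} \<in> box_edges (i, j)"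
  shows "fst u \<in> {i - 1, i}" "fst v \<in> {i - 1, i}" "snd u \<in> {j - 1, j}" "snd v \<in> {j - 1, j}"
  using assms by (auto simp: doubleton_eq_iff)

text \<open>Heights count downwards. If row \<open>i\<close> is empty, no edge of a box joins
  heights \<open>i\<close> and \<open>i - 1\<close>, so a walk from the bottom corner never reaches
  height 0.\<close>

lemma connected_row_nonempty:
  assumes "skew_connected lam mu" "1 \<le> i" "i \<le> length lam"
  shows "part mu i < part lam i"
proof (rule ccontr)
  assume empty: "\<not> part mu i < part lam i"
  obtain p where p: "edge_walk lam mu p"
    using assms(1) by (auto simp: skew_connected_def)
  have "i \<le> fst (last p)"
  proof (rule successively_invariant)
    show "successively (\<lambda>u v. \<exists>b\<in>skew_boxes lam mu. {u, v} \<in> box_edges b) p" "p \<noteq> []"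
      "i \<le> fst (hd p)"
      using p assms by (auto simp: edge_walk_def lower_left_def)
    fix u v :: vertex
    assume "\<exists>b\<in>skew_boxes lam mu. {u, v} \<in> box_edges b" and u: "i \<le> fst u"
    then obtain r c where b: "(r, c) \<in> skew_boxes lam mu" "{u, v} \<in> box_edges (r, c)" by auto
    then have "r \<noteq> i" using empty by (auto simp: skew_boxes_def)
    then show "i \<le> fst v" using box_edges_bounds[OF b(2)] u by auto
  qed
  then show False using p assms by (simp add: edge_walk_def upper_right_def)
qed

text \<open>Otherwise the rows up to \<open>i\<close> lie to the right of \<open>part mu i\<close>
  and the later rows to the left of the smaller \<open>part lam (i + 1)\<close>, and no walk gets
  across. Equality is allowed, since boxes may meet in a corner.\<close>

lemma connected_row_overlap:
  assumes "skew_pair lam mu" "skew_connected lam mu" "1 \<le> i" "i < length lam"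
  shows "part mu i \<le> part lam (i + 1)"
proof (rule ccontr)
  assume gap: "\<not> part mu i \<le> part lam (i + 1)"
  have lam: "is_partition lam" and mu: "is_partition mu" and le: "\<And>i. 1 \<le> i \<Longrightarrow> part mu i \<le> part lam i"
    using assms(1) by (auto simp: skew_pair_def)
  obtain p where p: "edge_walk lam mu p"
    using assms(2) by (auto simp: skew_connected_def)
  have "snd (last p) \<le> part lam (i + 1)"
  proof (rule successively_invariant)
    show "successively (\<lambda>u v. \<exists>b\<in>skew_boxes lam mu. {u, v} \<in> box_edges b) p" "p \<noteq> []"
      using p by (auto simp: edge_walk_def)
    show "snd (hd p) \<le> part lam (i + 1)"
      using p assms le[of "length lam"] part_antimono[OF lam, of "i + 1" "length lam"]
      by (simp add: edge_walk_def lower_left_def)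
    fix u v :: vertex
    assume "\<exists>b\<in>skew_boxes lam mu. {u, v} \<in> box_edges b" and u: "snd u \<le> part lam (i + 1)"
    then obtain r c where b: "(r, c) \<in> skew_boxes lam mu" "{u, v} \<in> box_edges (r, c)" by auto
    then have rc: "1 \<le> r" "part mu r < c" "c \<le> part lam r" by (auto simp: skew_boxes_def)
    show "snd v \<le> part lam (i + 1)"
    proof (cases "r \<le> i")
      case True
      then show ?thesis
        using part_antimono[OF mu rc(1) True] box_edges_bounds(3)[OF b(2)] u gap rc by auto
    next
      case False
      then have "c \<le> part lam (i + 1)"
        using part_antimono[OF lam, of "i + 1" r] rc by auto
      then show ?thesis using box_edges_bounds(4)[OF b(2)] by auto
    qed
  qed
  then show False
    using p gap le[of 1] part_antimono[OF mu, of 1 i] assms(3)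
    by (simp add: edge_walk_def upper_right_def)
qed

text \<open>The box may or may not belong to \<open>S\<close> already, so the criterion covers both
  overwriting an entry and adding a box.\<close>

lemma increasing_on_insert_iff:
  assumes "increasing_on S U"
  shows "increasing_on (insert (i, j) S) (U((i, j) := m)) \<longleftrightarrow>
    (\<forall>j'. (i, j') \<in> S \<longrightarrow> (j' < j \<longrightarrow> U (i, j') < m) \<and> (j < j' \<longrightarrow> m < U (i, j'))) \<and>
    (\<forall>i'. (i', j) \<in> S \<longrightarrow> (i' < i \<longrightarrow> U (i', j) < m) \<and> (i < i' \<longrightarrow> m < U (i', j)))"
  (is "?l \<longleftrightarrow> ?r")
proof
  assume l: ?l
  show ?r
    using l unfolding increasing_on_def
    by (smt (verit, ccfv_threshold) fun_upd_other fun_upd_same insertCI less_irrefl prod.inject)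
next
  assume ?r
  then show ?l
    using assms unfolding increasing_on_def by auto
qed

lemma is_skew_shapeI:
  fixes L M :: "nat \<Rightarrow> nat"
  assumes "\<And>i j. 1 \<le> i \<Longrightarrow> i \<le> j \<Longrightarrow> j \<le> k \<Longrightarrow> L j \<le> L i"
    and "\<And>i j. 1 \<le> i \<Longrightarrow> i \<le> j \<Longrightarrow> j \<le> k \<Longrightarrow> M j \<le> M i"
    and "\<And>i. 1 \<le> i \<Longrightarrow> i \<le> k \<Longrightarrow> M i \<le> L i"
  shows "is_skew_shape {(i, j). 1 \<le> i \<and> i \<le> k \<and> M i < j \<and> j \<le> L i}"
proof -
  \<comment> \<open>Parts must be positive but \<open>L\<close> and \<open>M\<close> may vanish.
    Adding 1 to both translates the shape by one column, which \<open>is_skew_shape\<close>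
    permits.\<close>
  define xs where "xs f = map (\<lambda>i. f i + 1) [1..<Suc k]" for f :: "nat \<Rightarrow> nat"
  have len: "length (xs f) = k" for f by (simp add: xs_def)
  have nth: "xs f ! i = f (i + 1) + 1" if "i < k" for f i
    using that by (simp add: xs_def del: upt_Suc)
  have part: "part (xs f) i = (if 1 \<le> i \<and> i \<le> k then f i + 1 else 0)" for f i
    by (auto simp: part_def len nth)
  have partition: "is_partition (xs f)"
    if "\<And>i j. 1 \<le> i \<Longrightarrow> i \<le> j \<Longrightarrow> j \<le> k \<Longrightarrow> f j \<le> f i" for f
    unfolding is_partition_def sorted_wrt_iff_nth_less using that
    by (auto simp: len nth) (auto simp: xs_def)
  have "skew_pair (xs L) (xs M)"
    using assms partition by (auto simp: skew_pair_def part)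
  moreover have "(\<lambda>(i, j). (i, j + 1)) ` {(i, j). 1 \<le> i \<and> i \<le> k \<and> M i < j \<and> j \<le> L i}
      = skew_boxes (xs L) (xs M)"
  proof (intro equalityI subsetI)
    fix b assume "b \<in> skew_boxes (xs L) (xs M)"
    then have "b = (\<lambda>(i, j). (i, j + 1)) (fst b, snd b - 1)"
      and "(fst b, snd b - 1) \<in> {(i, j). 1 \<le> i \<and> i \<le> k \<and> M i < j \<and> j \<le> L i}"
      by (auto simp: skew_boxes_def part len split: if_splits)
    then show "b \<in> (\<lambda>(i, j). (i, j + 1)) ` {(i, j). 1 \<le> i \<and> i \<le> k \<and> M i < j \<and> j \<le> L i}"
      by (rule image_eqI)
  qed (auto simp: skew_boxes_def part len)
  ultimately show ?thesis unfolding is_skew_shape_def by blast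
qed

text \<open>The ends of the rows weakly decrease downwards. An inadmissible added box is detected by
  a corner that this closure property demands and the shape lacks.\<close>

lemma is_skew_shape_closed:
  assumes "is_skew_shape S" "(i, j) \<in> S" "(i + 1, j + 1) \<in> S"
  shows "(i, j + 1) \<in> S" "(i + 1, j) \<in> S"
proof -
  obtain lam mu c where sp: "skew_pair lam mu"
    and eq: "(\<lambda>(i, j). (i, j + c)) ` S = skew_boxes lam mu"
    using assms(1) by (auto simp: is_skew_shape_def)
  have mem: "(r, s) \<in> S \<longleftrightarrow> (r, s + c) \<in> skew_boxes lam mu" for r s
    unfolding eq[symmetric] by force
  have "(i, j + c) \<in> skew_boxes lam mu" "(i + 1, j + 1 + c) \<in> skew_boxes lam mu"
    using assms(2,3) by (simp_all add: mem)
  moreover have "part lam (i + 1) \<le> part lam i" "part mu (i + 1) \<le> part mu i" if "1 \<le> i"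
    using sp that by (auto simp: skew_pair_def intro!: part_antimono)
  ultimately show "(i, j + 1) \<in> S" "(i + 1, j) \<in> S"
    unfolding mem by (auto simp: skew_boxes_def)
qed

text \<open>Connectedness enters the rest of the argument through these two row conditions.\<close>

locale connected_skew =
  fixes lam mu :: "nat list"
  assumes skew: "skew_pair lam mu"
    and row_nonempty: "1 \<le> i \<Longrightarrow> i \<le> length lam \<Longrightarrow> part mu i < part lam i"
    and row_overlap: "1 \<le> i \<Longrightarrow> i < length lam \<Longrightarrow> part mu i \<le> part lam (i + 1)"
begin

abbreviation k where "k \<equiv> length lam"
abbreviation L where "L \<equiv> part lam"
abbreviation M where "M \<equiv> part mu"
abbreviation S where "S \<equiv> skew_boxes lam mu"

lemma L_antimono: "1 \<le> i \<Longrightarrow> i \<le> j \<Longrightarrow> L j \<le> L i"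
  and M_antimono: "1 \<le> i \<Longrightarrow> i \<le> j \<Longrightarrow> M j \<le> M i"
  using skew by (auto simp: skew_pair_def intro: part_antimono)

lemma mem_S: "(i, j) \<in> S \<longleftrightarrow> 1 \<le> i \<and> i \<le> k \<and> M i < j \<and> j \<le> L i"
  by (simp add: skew_boxes_def)

lemma finite_S: "finite S"
proof (rule finite_subset)
  show "S \<subseteq> {1..k} \<times> {0..L 1}"
  proof (rule subrelI)
    fix i j assume "(i, j) \<in> S"
    then show "(i, j) \<in> {1..k} \<times> {0..L 1}"
      using L_antimono[of 1 i] by (auto simp: mem_S)
  qed
qed simp

text \<open>The last column of row \<open>i\<close> holding an entry below \<open>m\<close>. The values at \<open>0\<close> and beyond \<open>k\<close> make
  the staircase start and end at the corners of the shape.\<close>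

definition col :: "filling \<Rightarrow> nat \<Rightarrow> nat \<Rightarrow> nat" where
  "col T m i = (if i = 0 then L 1 else if i > k then M k
     else Max (insert (M i) {j. (i, j) \<in> S \<and> T (i, j) < m}))"

lemma finite_row: "finite {j. (i, j) \<in> S \<and> P j}"
  by (rule finite_subset[of _ "{0..L i}"]) (auto simp: mem_S)

lemma col_bounds:
  assumes "1 \<le> i" "i \<le> k"
  shows "M i \<le> col T m i" "col T m i \<le> L i"
  using assms finite_row row_nonempty[OF assms]
  by (auto simp: col_def mem_S)

text \<open>Rows increase, so the entries below \<open>m\<close> form an initial segment of the row,
  whose end is \<open>col\<close>.\<close>

lemma less_iff_col:
  assumes "increasing_on S T" "(i, j) \<in> S"
  shows "T (i, j) < m \<longleftrightarrow> j \<le> col T m i"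
proof -
  let ?A = "{j. (i, j) \<in> S \<and> T (i, j) < m}"
  have i: "1 \<le> i" "i \<le> k" and j: "M i < j" using assms(2) by (auto simp: mem_S)
  have c: "col T m i = Max (insert (M i) ?A)" using i by (simp add: col_def)
  show ?thesis
  proof
    assume "T (i, j) < m"
    then show "j \<le> col T m i" using assms finite_row by (auto simp: c intro: Max_ge)
  next
    assume le: "j \<le> col T m i"
    have "col T m i \<in> insert (M i) ?A" unfolding c using finite_row by (intro Max_in) auto
    with le j have "col T m i \<in> ?A" by auto
    then have "(i, col T m i) \<in> S" "T (i, col T m i) < m" by auto
    moreover have "T (i, j) \<le> T (i, col T m i)"
      using assms le \<open>(i, col T m i) \<in> S\<close> unfolding increasing_on_def
      by (metis le_eq_less_or_eq)
    ultimately show "T (i, j) < m" by simp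
  qed
qed

text \<open>If \<open>col T m (Suc i)\<close> exceeds \<open>M i\<close>, row \<open>i\<close> has a
  box in that column, above an entry below \<open>m\<close>, so its own entry is below
  \<open>m\<close>. Otherwise the lower bound \<open>M i\<close> suffices.\<close>

lemma col_Suc_le:
  assumes T: "increasing_on S T" and "i \<le> k"
  shows "col T m (Suc i) \<le> col T m i"
proof (cases "i = 0")
  case True
  show ?thesis
  proof (cases "k = 0")
    case True
    then show ?thesis using \<open>i = 0\<close> unfolding col_def part_def by simp
  next
    case False
    then have "col T m 1 \<le> L 1" by (intro col_bounds) (simp_all add: Suc_le_eq)
    then show ?thesis using \<open>i = 0\<close> by (simp add: col_def)
  qed
next
  case False
  show ?thesis
  proof (cases "i = k")
    case True
    then show ?thesis using False col_bounds(1)[of k T m] by (simp add: col_def Suc_leI)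
  next
    case False
    then have i: "1 \<le> i" "Suc i \<le> k" using \<open>i \<noteq> 0\<close> assms by auto
    let ?c = "col T m (Suc i)"
    note b = col_bounds[of i T m] col_bounds[of "Suc i" T m]
    show ?thesis
    proof (cases "?c \<le> M i")
      case True
      then show ?thesis using b i by simp
    next
      case False
      then have "(i, ?c) \<in> S" "(Suc i, ?c) \<in> S"
        using b i L_antimono[of i "Suc i"] M_antimono[of i "Suc i"] by (auto simp: mem_S)
      moreover from this have "T (Suc i, ?c) < m" "T (i, ?c) < T (Suc i, ?c)"
        using less_iff_col[OF T, of "Suc i" ?c m] T unfolding increasing_on_def by auto
      ultimately show ?thesis using less_iff_col[OF T, of i ?c m] by simp
    qed
  qed
qed

lemma col_antimono:
  assumes "increasing_on S T" "i \<le> j" "j \<le> Suc k"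
  shows "col T m j \<le> col T m i"
  using assms(2,3)
proof (induction j rule: dec_induct)
  case (step j)
  then show ?case using col_Suc_le[OF assms(1), of j m] by simp
qed simp

abbreviation ucol where "ucol U \<equiv> col U (missing S U)"

lemma aSYT_increasing: "U \<in> aSYT S \<Longrightarrow> increasing_on S U"
  by (simp add: aSYT_def)

lemma less_missing_iff:
  assumes "U \<in> aSYT S" "(i, j) \<in> S"
  shows "U (i, j) < missing S U \<longleftrightarrow> j \<le> ucol U i"
    and "missing S U < U (i, j) \<longleftrightarrow> ucol U i < j"
proof -
  have "U (i, j) \<noteq> missing S U"
    using missing_notin[OF finite_S assms(1)] assms(2) by (metis imageI)
  then show "U (i, j) < missing S U \<longleftrightarrow> j \<le> ucol U i" "missing S U < U (i, j) \<longleftrightarrow> ucol U i < j"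
    using less_iff_col[OF aSYT_increasing[OF assms(1)] assms(2), of "missing S U"] by auto
qed

lemma insert_missing_iff:
  assumes "U \<in> aSYT S"
  shows "increasing_on (insert (i, j) S) (U((i, j) := missing S U)) \<longleftrightarrow>
    (\<forall>j'. (i, j') \<in> S \<longrightarrow> (j' < j \<longrightarrow> j' \<le> ucol U i) \<and> (j < j' \<longrightarrow> ucol U i < j')) \<and>
    (\<forall>i'. (i', j) \<in> S \<longrightarrow> (i' < i \<longrightarrow> j \<le> ucol U i') \<and> (i < i' \<longrightarrow> ucol U i' < j))"
  unfolding increasing_on_insert_iff[OF aSYT_increasing[OF assms]]
  using less_missing_iff[OF assms] by (auto 4 4)

text \<open>An entry can be raised to the missing value only in the last small box of its row, and a
  box directly below must not be small. Since \<open>ucol\<close> weakly decreases downwards, this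
  controls all lower rows.\<close>

lemma movable_low_iff:
  assumes U: "U \<in> aSYT S" and b: "(i, j) \<in> S"
  shows "movable S U (i, j) \<and> U (i, j) < missing S U \<longleftrightarrow> j = ucol U i \<and> ucol U (Suc i) < j"
proof -
  note inc = aSYT_increasing[OF U]
  have i: "1 \<le> i" "i \<le> k" and j: "M i < j" "j \<le> L i" using b by (auto simp: mem_S)
  have mov: "movable S U (i, j) \<longleftrightarrow>
    (\<forall>j'. (i, j') \<in> S \<longrightarrow> (j' < j \<longrightarrow> j' \<le> ucol U i) \<and> (j < j' \<longrightarrow> ucol U i < j')) \<and>
    (\<forall>i'. (i', j) \<in> S \<longrightarrow> (i' < i \<longrightarrow> j \<le> ucol U i') \<and> (i < i' \<longrightarrow> ucol U i' < j))"
    using movable_iff[OF finite_S U b] insert_missing_iff[OF U, of i j] b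
    by (simp add: insert_absorb)
  note bd = col_bounds[OF i, of U "missing S U"]
  show ?thesis
  proof
    assume a: "movable S U (i, j) \<and> U (i, j) < missing S U"
    then have le: "j \<le> ucol U i" using less_missing_iff[OF U b] by simp
    have "(i, ucol U i) \<in> S" using le bd i j by (auto simp: mem_S)
    then have eq: "j = ucol U i" using a mov le by (meson le_neq_implies_less less_irrefl)
    have "ucol U (Suc i) < j"
    proof (rule ccontr)
      assume n: "\<not> ucol U (Suc i) < j"
      \<comment> \<open>In the last row, \<open>ucol U (Suc i)\<close> is \<open>M k\<close>, which
        is less than the column of any box of that row.\<close>
      have "i \<noteq> k" using n j by (auto simp: col_def)
      then have "(Suc i, j) \<in> S"
        using n i j M_antimono[of i "Suc i"] col_bounds[of "Suc i" U "missing S U"]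
        by (auto simp: mem_S)
      then show False using a mov n by blast
    qed
    with eq show "j = ucol U i \<and> ucol U (Suc i) < j" by simp
  next
    assume a: "j = ucol U i \<and> ucol U (Suc i) < j"
    have "movable S U (i, j)"
      unfolding mov
    proof (intro conjI allI impI)
      fix i' assume "(i', j) \<in> S" "i' < i"
      then show "j \<le> ucol U i'" using a i col_antimono[OF inc, of i' i] by simp
    next
      fix i' assume "(i', j) \<in> S" "i < i'"
      then show "ucol U i' < j"
        using a i col_antimono[OF inc, of "Suc i" i' "missing S U"] by (simp add: mem_S)
    qed (use a in auto)
    then show "movable S U (i, j) \<and> U (i, j) < missing S U"
      using a less_missing_iff[OF U b] by simp
  qed
qed

lemma movable_high_iff:
  assumes U: "U \<in> aSYT S" and b: "(i, j) \<in> S"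
  shows "movable S U (i, j) \<and> missing S U < U (i, j)
    \<longleftrightarrow> j = Suc (ucol U i) \<and> j \<le> ucol U (i - 1)"
proof -
  note inc = aSYT_increasing[OF U]
  have i: "1 \<le> i" "i \<le> k" and j: "M i < j" "j \<le> L i" using b by (auto simp: mem_S)
  have mov: "movable S U (i, j) \<longleftrightarrow>
    (\<forall>j'. (i, j') \<in> S \<longrightarrow> (j' < j \<longrightarrow> j' \<le> ucol U i) \<and> (j < j' \<longrightarrow> ucol U i < j')) \<and>
    (\<forall>i'. (i', j) \<in> S \<longrightarrow> (i' < i \<longrightarrow> j \<le> ucol U i') \<and> (i < i' \<longrightarrow> ucol U i' < j))"
    using movable_iff[OF finite_S U b] insert_missing_iff[OF U, of i j] b
    by (simp add: insert_absorb)
  note bd = col_bounds[OF i, of U "missing S U"]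
  show ?thesis
  proof
    assume a: "movable S U (i, j) \<and> missing S U < U (i, j)"
    then have less: "ucol U i < j" using less_missing_iff[OF U b] by simp
    have "(i, Suc (ucol U i)) \<in> S" using less bd i j by (auto simp: mem_S)
    then have eq: "j = Suc (ucol U i)" using a mov less
      by (metis Suc_lessI not_less_eq_eq order_refl)
    have "j \<le> ucol U (i - 1)"
    proof (rule ccontr)
      assume n: "\<not> j \<le> ucol U (i - 1)"
      \<comment> \<open>In row 1 the value \<open>L 1\<close> of \<open>col\<close> at 0 makes the
        condition on the row above hold for every box.\<close>
      have "i \<noteq> 1"
        using n j L_antimono[of 1 i] i by (auto simp: col_def)
      then have "1 \<le> i - 1" "i - 1 \<le> k" "i - 1 \<le> i" using i by auto
      then have "(i - 1, j) \<in> S"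
        using n j L_antimono[of "i - 1" i] col_bounds[of "i - 1" U "missing S U"]
        by (simp add: mem_S)
      moreover have "i - 1 < i" using i by simp
      ultimately show False using a mov n by blast
    qed
    with eq show "j = Suc (ucol U i) \<and> j \<le> ucol U (i - 1)" by simp
  next
    assume a: "j = Suc (ucol U i) \<and> j \<le> ucol U (i - 1)"
    have "movable S U (i, j)"
      unfolding mov
    proof (intro conjI allI impI)
      fix i' assume "(i', j) \<in> S" "i' < i"
      then have "ucol U (i - 1) \<le> ucol U i'"
        using i by (intro col_antimono[OF inc]) auto
      then show "j \<le> ucol U i'" using a by simp
    next
      fix i' assume "(i', j) \<in> S" "i < i'"
      then show "ucol U i' < j"
        using a i col_antimono[OF inc, of i i' "missing S U"] by (simp add: mem_S)
    qed (use a in auto)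
    then show "movable S U (i, j) \<and> missing S U < U (i, j)"
      using a less_missing_iff[OF U b] by simp
  qed
qed

section \<open>Extensions by one box at an end of a row\<close>

lemma insert_right_iff:
  assumes U: "U \<in> aSYT S" and i: "1 \<le> i" "i \<le> k" and out: "i = 1 \<or> L i < L (i - 1)"
  shows "increasing_on (insert (i, L i + 1) S) (U((i, L i + 1) := missing S U)) \<longleftrightarrow>
    (i = 1 \<or> ucol U i < ucol U (i - 1)) \<and> ucol U i = L i"
proof -
  note inc = aSYT_increasing[OF U]
  note bd = col_bounds[OF i, of U "missing S U"]
  show ?thesis
    unfolding insert_missing_iff[OF U]
  proof
    assume a: "(\<forall>j'. (i, j') \<in> S \<longrightarrow> (j' < L i + 1 \<longrightarrow> j' \<le> ucol U i) \<and> (L i + 1 < j' \<longrightarrow> ucol U i < j')) \<and>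
      (\<forall>i'. (i', L i + 1) \<in> S \<longrightarrow> (i' < i \<longrightarrow> L i + 1 \<le> ucol U i') \<and> (i < i' \<longrightarrow> ucol U i' < L i + 1))"
    have "(i, L i) \<in> S" using i row_nonempty by (simp add: mem_S)
    then have eq: "ucol U i = L i" using a bd by fastforce
    \<comment> \<open>A box directly above the new one must have a small entry; if there is none,
      the bound \<open>M (i - 1)\<close> gives the inequality.\<close>
    have "ucol U i < ucol U (i - 1)" if "i \<noteq> 1"
    proof (cases "M (i - 1) \<le> L i")
      case True
      then have "(i - 1, L i + 1) \<in> S" using that i out by (auto simp: mem_S)
      moreover have "i - 1 < i" using i by simp
      ultimately have "L i + 1 \<le> ucol U (i - 1)" using a by blast
      then show ?thesis using eq by simp
    next
      case False
      moreover have "1 \<le> i - 1" "i - 1 \<le> k" using that i by auto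
      ultimately show ?thesis using eq col_bounds(1)[of "i - 1" U "missing S U"] by simp
    qed
    then show "(i = 1 \<or> ucol U i < ucol U (i - 1)) \<and> ucol U i = L i" using eq by blast
  next
    assume a: "(i = 1 \<or> ucol U i < ucol U (i - 1)) \<and> ucol U i = L i"
    show "(\<forall>j'. (i, j') \<in> S \<longrightarrow> (j' < L i + 1 \<longrightarrow> j' \<le> ucol U i) \<and> (L i + 1 < j' \<longrightarrow> ucol U i < j')) \<and>
      (\<forall>i'. (i', L i + 1) \<in> S \<longrightarrow> (i' < i \<longrightarrow> L i + 1 \<le> ucol U i') \<and> (i < i' \<longrightarrow> ucol U i' < L i + 1))"
    proof (intro conjI allI impI)
      fix i' assume i': "(i', L i + 1) \<in> S" "i' < i"
      then have "ucol U (i - 1) \<le> ucol U i'"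
        using i by (intro col_antimono[OF inc]) auto
      moreover have "i \<noteq> 1" using i' by (auto simp: mem_S)
      ultimately show "L i + 1 \<le> ucol U i'" using a by simp
    next
      fix i' assume "(i', L i + 1) \<in> S" "i < i'"
      then show "ucol U i' < L i + 1"
        using i L_antimono[of i i'] by (auto simp: mem_S)
    qed (use a in auto)
  qed
qed

text \<open>The new box receives the missing value, so all entries of row \<open>i\<close> must be
  large, and so must an entry directly below the new box.\<close>

lemma insert_left_iff:
  assumes U: "U \<in> aSYT S" and i: "1 \<le> i" "i < k" and out: "M (Suc i) < M i"
  shows "increasing_on (insert (i, M i) S) (U((i, M i) := missing S U)) \<longleftrightarrow>
    ucol U (Suc i) < ucol U i \<and> ucol U i = M i"
proof -
  note inc = aSYT_increasing[OF U]
  note bd = col_bounds[OF i(1) less_imp_le[OF i(2)], of U "missing S U"]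
  show ?thesis
    unfolding insert_missing_iff[OF U]
  proof
    assume a: "(\<forall>j'. (i, j') \<in> S \<longrightarrow> (j' < M i \<longrightarrow> j' \<le> ucol U i) \<and> (M i < j' \<longrightarrow> ucol U i < j')) \<and>
      (\<forall>i'. (i', M i) \<in> S \<longrightarrow> (i' < i \<longrightarrow> M i \<le> ucol U i') \<and> (i < i' \<longrightarrow> ucol U i' < M i))"
    have "(i, M i + 1) \<in> S" using i row_nonempty[of i] by (simp add: mem_S)
    then have eq: "ucol U i = M i" using a bd by fastforce
    have "ucol U (Suc i) < ucol U i"
    proof (cases "M i \<le> L (Suc i)")
      case True
      then have "(Suc i, M i) \<in> S" using i out by (auto simp: mem_S)
      then show ?thesis using a eq by auto
    next
      case False
      then show ?thesis using i eq col_bounds[of "Suc i" U "missing S U"] by simp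
    qed
    then show "ucol U (Suc i) < ucol U i \<and> ucol U i = M i" using eq by blast
  next
    assume a: "ucol U (Suc i) < ucol U i \<and> ucol U i = M i"
    show "(\<forall>j'. (i, j') \<in> S \<longrightarrow> (j' < M i \<longrightarrow> j' \<le> ucol U i) \<and> (M i < j' \<longrightarrow> ucol U i < j')) \<and>
      (\<forall>i'. (i', M i) \<in> S \<longrightarrow> (i' < i \<longrightarrow> M i \<le> ucol U i') \<and> (i < i' \<longrightarrow> ucol U i' < M i))"
    proof (intro conjI allI impI)
      fix i' assume "(i', M i) \<in> S" "i' < i"
      then show "M i \<le> ucol U i'"
        using M_antimono[of i' i] by (auto simp: mem_S)
    next
      fix i' assume "(i', M i) \<in> S" "i < i'"
      then show "ucol U i' < M i"
        using a i col_antimono[OF inc, of "Suc i" i' "missing S U"] by (auto simp: mem_S)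
    qed (use a in auto)
  qed
qed

lemma is_skew_shape_right_iff:
  assumes i: "1 \<le> i" "i \<le> k"
  shows "is_skew_shape (insert (i, L i + 1) S) \<longleftrightarrow> i = 1 \<or> L i < L (i - 1)"
proof
  assume sk: "is_skew_shape (insert (i, L i + 1) S)"
  show "i = 1 \<or> L i < L (i - 1)"
  proof (rule ccontr)
    assume n: "\<not> (i = 1 \<or> L i < L (i - 1))"
    moreover from n have "1 \<le> i - 1" using i by auto
    ultimately have "1 \<le> i - 1" "L (i - 1) \<le> L i" by auto
    with i have eq: "L (i - 1) = L i" using L_antimono[of "i - 1" i] by simp
    \<comment> \<open>This box and the new one are diagonal neighbours, so a skew shape would also
      contain \<open>(i - 1, L i + 1)\<close>, beyond the end of row \<open>i - 1\<close>.\<close>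
    have "(i - 1, L i) \<in> S"
      using \<open>1 \<le> i - 1\<close> i eq row_nonempty[of "i - 1"] by (auto simp: mem_S)
    then have "(i - 1, L i + 1) \<in> insert (i, L i + 1) S"
      using is_skew_shape_closed(1)[OF sk, of "i - 1" "L i"] i by simp
    then show False using i eq by (auto simp: mem_S)
  qed
next
  assume out: "i = 1 \<or> L i < L (i - 1)"
  let ?L = "\<lambda>r. if r = i then L i + 1 else L r"
  have "insert (i, L i + 1) S = {(r, j). 1 \<le> r \<and> r \<le> k \<and> M r < j \<and> j \<le> ?L r}"
    using i row_nonempty[of i] by (auto simp: mem_S split: if_splits)
  also have "is_skew_shape \<dots>"
  proof (rule is_skew_shapeI)
    fix r s assume rs: "1 \<le> r" "r \<le> s" "s \<le> k"
    show "M s \<le> M r" using rs M_antimono by simp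
    have "L (i - 1) \<le> L r" if "r < i"
      using that rs by (intro L_antimono) auto
    then show "?L s \<le> ?L r"
      using rs L_antimono[of r s] out by auto
  next
    fix r assume "1 \<le> r" "r \<le> k"
    then show "M r \<le> ?L r" using row_nonempty[of r] by auto
  qed
  finally show "is_skew_shape (insert (i, L i + 1) S)" .
qed

lemma is_skew_shape_left_iff:
  assumes i: "1 \<le> i" "i < k"
  shows "is_skew_shape (insert (i, M i) S) \<longleftrightarrow> M (Suc i) < M i"
proof
  assume sk: "is_skew_shape (insert (i, M i) S)"
  show "M (Suc i) < M i"
  proof (rule ccontr)
    assume n: "\<not> M (Suc i) < M i"
    then have eq: "M (Suc i) = M i" using i M_antimono[of i "Suc i"] by simp
    have "(Suc i, M i + 1) \<in> S"
      using i row_nonempty[of "Suc i"] by (auto simp: mem_S eq)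
    then have "(Suc i, M i) \<in> insert (i, M i) S"
      using is_skew_shape_closed(2)[OF sk, of i "M i"] i by simp
    then show False using i by (auto simp: mem_S eq)
  qed
next
  assume out: "M (Suc i) < M i"
  let ?M = "\<lambda>r. if r = i then M i - 1 else M r"
  have "insert (i, M i) S = {(r, j). 1 \<le> r \<and> r \<le> k \<and> ?M r < j \<and> j \<le> L r}"
    using i row_nonempty[of i] out by (auto simp: mem_S split: if_splits)
  also have "is_skew_shape \<dots>"
  proof (rule is_skew_shapeI)
    fix r s assume rs: "1 \<le> r" "r \<le> s" "s \<le> k"
    show "L s \<le> L r" using rs L_antimono by simp
    show "?M s \<le> ?M r"
      using rs M_antimono[of r s] out M_antimono[of "Suc i" s] by auto
  next
    fix r assume "1 \<le> r" "r \<le> k"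
    then show "?M r \<le> L r" using row_nonempty[of r] by auto
  qed
  finally show "is_skew_shape (insert (i, M i) S)" .
qed

text \<open>The formula covers inadmissible extensions too: then \<open>L (i - 1) \<le> L i\<close>
  bounds \<open>ucol U (i - 1)\<close> and both sides vanish. The case \<open>i = 1\<close> is
  separate because \<open>col\<close> is \<open>L 1\<close> at 0, a value that a full first row
  attains.\<close>

lemma num_SYT_right_eq:
  assumes i: "1 \<le> i" "i \<le> k"
  shows "num_SYT_right lam mu i =
    card {U \<in> aSYT S. (i = 1 \<or> ucol U i < ucol U (i - 1)) \<and> ucol U i = L i}"
proof (cases "i = 1 \<or> L i < L (i - 1)")
  case True
  have "(i, L i + 1) \<notin> S" by (simp add: mem_S)
  then have "num_SYT_right lam mu i = card {U \<in> aSYT S.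
      increasing_on (insert (i, L i + 1) S) (U((i, L i + 1) := missing S U))}"
    using is_skew_shape_right_iff[OF i] True
    by (simp add: num_SYT_right_def num_SYT_insert[OF finite_S])
  also have "\<dots> = card {U \<in> aSYT S. (i = 1 \<or> ucol U i < ucol U (i - 1)) \<and> ucol U i = L i}"
    by (intro arg_cong[where f = card] Collect_cong conj_cong refl insert_right_iff i True)
  finally show ?thesis .
next
  case False
  then have "1 \<le> i - 1" "i - 1 \<le> k" "L (i - 1) \<le> L i" using i by auto
  then have "ucol U (i - 1) \<le> L i" for U
    using col_bounds(2)[of "i - 1" U "missing S U"] by simp
  then have "{U \<in> aSYT S. (i = 1 \<or> ucol U i < ucol U (i - 1)) \<and> ucol U i = L i} = {}"
    using False by (metis (mono_tags, lifting) empty_Collect_eq not_le)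
  then show ?thesis
    using False is_skew_shape_right_iff[OF i] by (simp only: num_SYT_right_def Let_def if_False card.empty)
qed

lemma num_SYT_left_eq:
  assumes i: "1 \<le> i" "i < k"
  shows "num_SYT_left lam mu i =
    card {U \<in> aSYT S. ucol U (Suc i) < ucol U i \<and> ucol U i = M i}"
proof (cases "M (Suc i) < M i")
  case True
  have "(i, M i) \<notin> S" by (simp add: mem_S)
  then have "num_SYT_left lam mu i = card {U \<in> aSYT S.
      increasing_on (insert (i, M i) S) (U((i, M i) := missing S U))}"
    using is_skew_shape_left_iff[OF i] True
    by (simp add: num_SYT_left_def num_SYT_insert[OF finite_S])
  also have "\<dots> = card {U \<in> aSYT S. ucol U (Suc i) < ucol U i \<and> ucol U i = M i}"
    by (intro arg_cong[where f = card] Collect_cong conj_cong refl insert_left_iff i True)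
  finally show ?thesis .
next
  case False
  have "M i \<le> ucol U (Suc i)" for U
    using False i col_bounds(1)[of "Suc i" U "missing S U"] by simp
  then have "{U \<in> aSYT S. ucol U (Suc i) < ucol U i \<and> ucol U i = M i} = {}"
    by (metis (mono_tags, lifting) empty_Collect_eq not_le)
  then show ?thesis
    using False is_skew_shape_left_iff[OF i] by (simp only: num_SYT_left_def Let_def if_False card.empty)
qed

end

section \<open>Counting the edges row by row\<close>

lemma card_split:
  assumes "finite A" "\<And>x. x \<in> A \<Longrightarrow> P x \<longleftrightarrow> Q x \<or> R x" "\<And>x. x \<in> A \<Longrightarrow> \<not> (Q x \<and> R x)"
  shows "card {x \<in> A. P x} = card {x \<in> A. Q x} + card {x \<in> A. R x}"
proof -
  have "{x \<in> A. P x} = {x \<in> A. Q x} \<union> {x \<in> A. R x}" using assms(2) by blast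
  then show ?thesis using assms by (auto intro: card_Un_disjoint)
qed

text \<open>Unrolled, \<open>x i\<close> is \<open>N\<close> plus the earlier \<open>l\<close> minus
  the earlier \<open>r\<close>. In the sum of \<open>e i = x i - r i\<close>, the term
  \<open>l j\<close> is counted for each \<open>i > j\<close> and \<open>r j\<close> for each
  \<open>i \<ge> j\<close>, which gives the weights. As \<open>l k\<close> has weight 0, the
  recursion stops before it.\<close>

lemma sum_telescoping_weights:
  fixes x e l r :: "nat \<Rightarrow> int"
  assumes "x 1 = N"
    and out: "\<And>i. 1 \<le> i \<Longrightarrow> i \<le> k \<Longrightarrow> x i = e i + r i"
    and step: "\<And>i. 1 \<le> i \<Longrightarrow> i < k \<Longrightarrow> x (Suc i) = e i + l i"
  shows "(\<Sum>i=1..k. e i) = int k * N + (\<Sum>i=1..k. (int k - int i) * l i)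
    - (\<Sum>i=1..k. (int k + 1 - int i) * r i)"
proof -
  have x: "x (Suc n) = N + (\<Sum>i=1..n. l i) - (\<Sum>i=1..n. r i)" if "n < k" for n
    using that
  proof (induction n)
    case (Suc n)
    then show ?case using out[of "Suc n"] step[of "Suc n"] by simp
  qed (use assms(1) in simp)
  have "(\<Sum>i=1..n. e i) = int n * N + (\<Sum>i=1..n. (int n - int i) * l i)
      - (\<Sum>i=1..n. (int n + 1 - int i) * r i)" if "n \<le> k" for n
    using that
  proof (induction n)
    case (Suc n)
    have "e (Suc n) = N + (\<Sum>i=1..n. l i) - (\<Sum>i=1..n. r i) - r (Suc n)"
      using x[of n] out[of "Suc n"] Suc.prems by simp
    moreover have "(\<Sum>i=1..n. (int (Suc n) - int i) * l i)
        = (\<Sum>i=1..n. (int n - int i) * l i) + (\<Sum>i=1..n. l i)"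
      by (simp add: sum.distrib[symmetric] algebra_simps)
    moreover have "(\<Sum>i=1..n. (int (Suc n) + 1 - int i) * r i)
        = (\<Sum>i=1..n. (int n + 1 - int i) * r i) + (\<Sum>i=1..n. r i)"
      by (simp add: sum.distrib[symmetric] algebra_simps)
    ultimately show ?case using Suc by (simp add: algebra_simps)
  qed simp
  then show ?thesis by blast
qed

context connected_skew
begin

text \<open>The tableau determines the only column of row \<open>i\<close> where an entry can be
  lowered, so forgetting the box is injective.\<close>

lemma card_high_moves_row:
  assumes i: "1 \<le> i" "i \<le> k"
  shows "card {x \<in> high_moves S. fst (snd x) = i} =
    card {U \<in> aSYT S. (i = 1 \<or> ucol U i < ucol U (i - 1)) \<and> ucol U i < L i}"
    (is "card ?A = card ?B")
proof (rule bij_betw_same_card)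
  have iff: "(U, (i, j)) \<in> high_moves S \<longleftrightarrow>
      U \<in> aSYT S \<and> (i, j) \<in> S \<and> j = Suc (ucol U i) \<and> j \<le> ucol U (i - 1)" for U j
    using movable_high_iff[of U i j] by (auto simp: high_moves_def movable_def)
  have mem: "(i, Suc (ucol U i)) \<in> S \<longleftrightarrow> ucol U i < L i" for U
    using i col_bounds[OF i, of U "missing S U"] by (auto simp: mem_S)
  \<comment> \<open>For \<open>i = 1\<close> the bound by \<open>ucol U 0 = L 1\<close> amounts to
    \<open>ucol U i < L i\<close>.\<close>
  have "(U, (i, j)) \<in> high_moves S \<longleftrightarrow> U \<in> ?B \<and> j = Suc (ucol U i)" for U j
    using iff[of U j] mem[of U] by (auto simp: col_def[of _ _ 0])
  then show "bij_betw fst ?A ?B"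
    by (intro bij_betw_byWitness[where f' = "\<lambda>U. (U, (i, Suc (ucol U i)))"]) auto
qed

lemma card_low_moves_row:
  assumes i: "1 \<le> i" "i < k"
  shows "card {x \<in> low_moves S. fst (snd x) = i} =
    card {U \<in> aSYT S. ucol U (Suc i) < ucol U i \<and> M i < ucol U i}"
    (is "card ?A = card ?B")
proof (rule bij_betw_same_card)
  have iff: "(U, (i, j)) \<in> low_moves S \<longleftrightarrow>
      U \<in> aSYT S \<and> (i, j) \<in> S \<and> j = ucol U i \<and> ucol U (Suc i) < j" for U j
    using movable_low_iff[of U i j] by (auto simp: low_moves_def movable_def)
  have mem: "(i, ucol U i) \<in> S \<longleftrightarrow> M i < ucol U i" for U
    using i col_bounds[of i U "missing S U"] by (auto simp: mem_S)
  have "(U, (i, j)) \<in> low_moves S \<longleftrightarrow> U \<in> ?B \<and> j = ucol U i" for U j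
    using iff[of U j] mem[of U] by auto
  then show "bij_betw fst ?A ?B"
    by (intro bij_betw_byWitness[where f' = "\<lambda>U. (U, (i, ucol U i))"]) auto
qed

lemma card_low_moves:
  "int (card (low_moves S)) =
     int k * (int (card S) + 1) * int (num_SYT S)
     + (\<Sum>i=1..k. (int k - int i) * int (num_SYT_left lam mu i))
     - (\<Sum>i=1..k. (int k + 1 - int i) * int (num_SYT_right lam mu i))"
proof -
  let ?e = "\<lambda>i. card {x \<in> low_moves S. fst (snd x) = i}"
  \<comment> \<open>For \<open>i = 1\<close> the condition is vacuous, so the telescoping starts
    from the number of vertices.\<close>
  let ?x = "\<lambda>i. card {U \<in> aSYT S. i = 1 \<or> ucol U i < ucol U (i - 1)}"
  have "(\<Sum>i=1..k. \<Sum>x\<in>{x \<in> low_moves S. fst (snd x) = i}. 1) = (\<Sum>x\<in>low_moves S. 1 :: nat)"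
  proof (rule sum.group)
    show "(\<lambda>x. fst (snd x)) ` low_moves S \<subseteq> {1..k}"
      by (auto simp: low_moves_def movable_def mem_S)
  qed (simp_all add: finite_moves finite_S)
  then have "card (low_moves S) = (\<Sum>i=1..k. ?e i)" by simp
  then have "int (card (low_moves S)) = (\<Sum>i=1..k. int (?e i))" by simp
  also have "\<dots> = int k * int (card (aSYT S))
      + (\<Sum>i=1..k. (int k - int i) * int (num_SYT_left lam mu i))
      - (\<Sum>i=1..k. (int k + 1 - int i) * int (num_SYT_right lam mu i))"
  proof (rule sum_telescoping_weights[where x = "\<lambda>i. int (?x i)"])
    show "int (?x 1) = int (card (aSYT S))" by simp
    fix i assume i: "1 \<le> i" "i \<le> k"
    have "?x i = card {U \<in> aSYT S. (i = 1 \<or> ucol U i < ucol U (i - 1)) \<and> ucol U i < L i}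
        + card {U \<in> aSYT S. (i = 1 \<or> ucol U i < ucol U (i - 1)) \<and> ucol U i = L i}"
      using col_bounds(2)[OF i] by (intro card_split finite_aSYT finite_S) (auto simp: le_less)
    \<comment> \<open>Row \<open>i\<close> is counted here by high moves and in the other recursion
      by low moves; the counts agree because a move keeps its box.\<close>
    then show "int (?x i) = int (?e i) + int (num_SYT_right lam mu i)"
      using card_low_eq_high[OF finite_S, of "\<lambda>b. fst b = i"]
      by (simp only: card_high_moves_row[OF i] num_SYT_right_eq[OF i] of_nat_add)
  next
    fix i assume i: "1 \<le> i" "i < k"
    have "?x (Suc i) = card {U \<in> aSYT S. ucol U (Suc i) < ucol U i \<and> M i < ucol U i}
        + card {U \<in> aSYT S. ucol U (Suc i) < ucol U i \<and> ucol U i = M i}"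
      using col_bounds(1)[OF i(1) less_imp_le[OF i(2)]] i
      by (intro card_split finite_aSYT finite_S) (auto simp: le_neq_implies_less)
    then show "int (?x (Suc i)) = int (?e i) + int (num_SYT_left lam mu i)"
      by (simp only: card_low_moves_row[OF i] num_SYT_left_eq[OF i] of_nat_add)
  qed
  finally show ?thesis
    by (simp add: card_aSYT[OF finite_S] algebra_simps)
qed

text \<open>A handshake count: each edge is a low move from one end and a high move from the
  other.\<close>

lemma sum_movable:
  "(\<Sum>U\<in>aSYT S. card {b \<in> S. movable S U b}) = 2 * card (low_moves S)"
proof -
  have "card {b \<in> S. movable S U b} =
      card {b \<in> S. movable S U b \<and> U b < missing S U} + card {b \<in> S. movable S U b \<and> missing S U < U b}"
    if "U \<in> aSYT S" for U
  proof (rule card_split[OF finite_S])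
    fix b assume "b \<in> S"
    then have "U b \<noteq> missing S U" using missing_notin[OF finite_S that] by (metis imageI)
    then show "movable S U b \<longleftrightarrow> movable S U b \<and> U b < missing S U \<or> movable S U b \<and> missing S U < U b"
      by auto
  qed auto
  moreover have "low_moves S = Sigma (aSYT S) (\<lambda>U. {b \<in> S. movable S U b \<and> U b < missing S U})"
    and "high_moves S = Sigma (aSYT S) (\<lambda>U. {b \<in> S. movable S U b \<and> missing S U < U b})"
    by (auto simp: low_moves_def high_moves_def movable_def)
  then have "card (low_moves S) = (\<Sum>U\<in>aSYT S. card {b \<in> S. movable S U b \<and> U b < missing S U})"
    and "card (high_moves S) = (\<Sum>U\<in>aSYT S. card {b \<in> S. movable S U b \<and> missing S U < U b})"
    by (simp_all add: card_SigmaI finite_aSYT finite_S)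
  moreover have "card (low_moves S) = card (high_moves S)"
    using card_low_eq_high[OF finite_S, of "\<lambda>_. True"] by simp
  ultimately show ?thesis by (simp add: sum.distrib)
qed

end

section \<open>Staircase paths\<close>

text \<open>At height \<open>r\<close> the path of the profile \<open>a\<close> runs from column
  \<open>a (Suc r)\<close> to column \<open>a r\<close>, where it goes up past row
  \<open>r\<close>.\<close>

primrec stair :: "(nat \<Rightarrow> nat) \<Rightarrow> nat \<Rightarrow> vertex list" where
  "stair a 0 = map (Pair 0) [a 1..<Suc (a 0)]"
| "stair a (Suc r) = map (Pair (Suc r)) [a (Suc (Suc r))..<Suc (a (Suc r))] @ stair a r"

lemma successively_row:
  assumes "\<And>c. m \<le> c \<Longrightarrow> c < n \<Longrightarrow> P (r, c) (r, Suc c)"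
  shows "successively P (map (Pair r) [m..<Suc n])"
  unfolding successively_conv_nth
proof (intro allI impI)
  fix t assume "Suc t < length (map (Pair r) [m..<Suc n])"
  then have "Suc (m + t) < Suc n" by (simp del: upt_Suc)
  then have "map (Pair r) [m..<Suc n] ! t = (r, m + t)"
    "map (Pair r) [m..<Suc n] ! Suc t = (r, Suc (m + t))"
    by (simp_all del: upt_Suc)
  then show "P (map (Pair r) [m..<Suc n] ! t) (map (Pair r) [m..<Suc n] ! Suc t)"
    using assms \<open>Suc (m + t) < Suc n\<close> by simp
qed

lemma stair_props:
  assumes "\<And>i. i \<le> r \<Longrightarrow> a (Suc i) \<le> a i"
  shows stair_nonempty: "stair a r \<noteq> []"
    and hd_stair: "hd (stair a r) = (r, a (Suc r))"
    and last_stair: "last (stair a r) = (0, a 0)"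
    and set_stair: "set (stair a r) = {(i, c). i \<le> r \<and> a (Suc i) \<le> c \<and> c \<le> a i}"
proof -
  have "stair a r \<noteq> [] \<and> hd (stair a r) = (r, a (Suc r)) \<and> last (stair a r) = (0, a 0) \<and>
    set (stair a r) = {(i, c). i \<le> r \<and> a (Suc i) \<le> c \<and> c \<le> a i}"
    using assms
  proof (induction r)
    case 0
    then show ?case by (auto simp: hd_map last_map simp del: upt_Suc)
  next
    case (Suc r)
    then have IH: "stair a r \<noteq> []" "last (stair a r) = (0, a 0)"
      "set (stair a r) = {(i, c). i \<le> r \<and> a (Suc i) \<le> c \<and> c \<le> a i}" by auto
    have le: "a (Suc (Suc r)) \<le> a (Suc r)" using Suc.prems by simp
    then have "hd (stair a (Suc r)) = (Suc r, a (Suc (Suc r)))"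
      by (simp add: hd_map hd_append upt_conv_Cons)
    then show ?case using IH le by (auto simp: le_Suc_eq)
  qed
  then show "stair a r \<noteq> []" "hd (stair a r) = (r, a (Suc r))" "last (stair a r) = (0, a 0)"
    "set (stair a r) = {(i, c). i \<le> r \<and> a (Suc i) \<le> c \<and> c \<le> a i}" by blast+
qed

lemma successively_stair:
  assumes "\<And>i. i \<le> r \<Longrightarrow> a (Suc i) \<le> a i"
    and "\<And>i c. i \<le> r \<Longrightarrow> a (Suc i) \<le> c \<Longrightarrow> c < a i \<Longrightarrow> P (i, c) (i, Suc c)"
    and "\<And>i. i < r \<Longrightarrow> P (Suc i, a (Suc i)) (i, a (Suc i))"
  shows "successively P (stair a r)"
  using assms
proof (induction r)
  case 0
  then show ?case by (simp add: successively_row del: upt_Suc)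
next
  case (Suc r)
  let ?row = "map (Pair (Suc r)) [a (Suc (Suc r))..<Suc (a (Suc r))]"
  have le: "a (Suc (Suc r)) \<le> a (Suc r)" using Suc.prems(1) by simp
  have "successively P ?row" using Suc.prems(2) by (intro successively_row) simp
  moreover have "successively P (stair a r)" using Suc by simp
  moreover have "last ?row = (Suc r, a (Suc r))" using le by simp
  moreover have "hd (stair a r) = (r, a (Suc r))" using Suc.prems(1) by (intro hd_stair) simp
  moreover have "P (Suc r, a (Suc r)) (r, a (Suc r))" using Suc.prems(3) by simp
  ultimately show ?case by (simp add: successively_append_iff del: upt_Suc)
qed

definition stair_step :: "vertex \<Rightarrow> vertex \<Rightarrow> bool" where
  "stair_step u v \<longleftrightarrow> right_step u v \<or> up_step u v"

lemma stair_step_nth: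
  assumes "successively stair_step p" "Suc t < length p"
  shows "stair_step (p ! t) (p ! Suc t)"
  using assms by (simp add: successively_conv_nth)

text \<open>Right and up steps both increase column minus row by 1.\<close>

lemma content_nth:
  assumes "successively stair_step p" "t < length p"
  shows "int (snd (p ! t)) - int (fst (p ! t)) = int (snd (hd p)) - int (fst (hd p)) + int t"
  using assms(2)
proof (induction t)
  case 0
  then show ?case by (simp add: hd_conv_nth)
next
  case (Suc t)
  then show ?case using stair_step_nth[OF assms(1), of t]
    by (auto simp: stair_step_def right_step_def up_step_def)
qed

lemma stair_step_mono:
  assumes "successively stair_step p" "s \<le> t" "t < length p"
  shows "fst (p ! t) \<le> fst (p ! s)" "snd (p ! s) \<le> snd (p ! t)"
proof -
  have "fst (p ! t) \<le> fst (p ! s) \<and> snd (p ! s) \<le> snd (p ! t)"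
    using assms(2,3)
  proof (induction t rule: dec_induct)
    case (step t)
    then show ?case using stair_step_nth[OF assms(1), of t]
      by (auto simp: stair_step_def right_step_def up_step_def)
  qed simp
  then show "fst (p ! t) \<le> fst (p ! s)" "snd (p ! s) \<le> snd (p ! t)" by auto
qed

text \<open>The content of a vertex determines its position on a staircase path, so the \<open>t\<close>-th step is
  recovered from membership of its endpoints.\<close>

lemma nth_eq_content:
  assumes "successively stair_step p" "t < length p" "v \<in> set p"
    and "int (snd v) - int (fst v) = int (snd (p ! t)) - int (fst (p ! t)) + int d"
  shows "t + d < length p" "p ! (t + d) = v"
proof -
  obtain s where s: "s < length p" "v = p ! s" using assms(3) by (auto simp: in_set_conv_nth)
  then have "s = t + d"
    using content_nth[OF assms(1) s(1)] content_nth[OF assms(1,2)] assms(4) by simp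
  with s show "t + d < length p" "p ! (t + d) = v" by auto
qed

lemma horizontal_edge:
  assumes "{(r, c), (r, Suc c)} \<in> box_edges (i, j)" "1 \<le> i" "1 \<le> j"
  shows "j = Suc c \<and> (i = r \<or> i = Suc r)"
  using assms by (cases i; cases j) (auto simp: doubleton_eq_iff)

lemma vertical_edge:
  assumes "{(r, c), (Suc r, c)} \<in> box_edges (i, j)" "1 \<le> i" "1 \<le> j"
  shows "i = Suc r \<and> (j = c \<or> j = Suc c)"
  using assms by (cases i; cases j) (auto simp: doubleton_eq_iff)

text \<open>A turn at box \<open>(i, j)\<close> passes its lower left and upper right corners, and
  the lower right one if it goes right and then up, the upper left one if it goes up and then right.
  In this form only the vertex set of the path matters.\<close>

definition path_corner :: "vertex list \<Rightarrow> box \<Rightarrow> bool" where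
  "path_corner p b = (case b of (i, j) \<Rightarrow> (i, j - 1) \<in> set p \<and> (i - 1, j) \<in> set p \<and>
     ((i, j) \<in> set p \<or> (i - 1, j - 1) \<in> set p))"

text \<open>Either kind of turn starts at the lower left corner of the box it borders, so position
  and box determine each other.\<close>

lemma turns_eq_card_corners:
  assumes p: "successively stair_step p" and pos: "\<And>i j. (i, j) \<in> S \<Longrightarrow> 1 \<le> i \<and> 1 \<le> j"
  shows "turns S p = card {b \<in> S. path_corner p b}"
  unfolding turns_def
proof (rule bij_betw_same_card)
  let ?A = "{t. t + 2 < length p \<and> is_turn S (p ! t) (p ! (t + 1)) (p ! (t + 2))}"
  let ?f = "\<lambda>t. (fst (p ! t), Suc (snd (p ! t)))"
  show "bij_betw ?f ?A {b \<in> S. path_corner p b}"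
  proof (rule bij_betw_imageI)
    show "inj_on ?f ?A"
    proof (rule inj_onI)
      fix s t assume "s \<in> ?A" "t \<in> ?A" and f: "?f s = ?f t"
      then have "s < length p" "t < length p" by auto
      note c = this[THEN content_nth[OF p]]
      have "fst (p ! s) = fst (p ! t)" "snd (p ! s) = snd (p ! t)" using f by auto
      then show "s = t" using c by linarith
    qed
    show "?f ` ?A = {b \<in> S. path_corner p b}"
    proof (intro equalityI subsetI)
      fix b assume "b \<in> ?f ` ?A"
      then obtain t where t: "t + 2 < length p" "is_turn S (p ! t) (p ! (t + 1)) (p ! (t + 2))"
        and b: "b = ?f t" by blast
      obtain r c where u: "p ! t = (r, c)" by (cases "p ! t")
      obtain r' c' where v: "p ! (t + 1) = (r', c')" by (cases "p ! (t + 1)")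
      obtain r'' c'' where w: "p ! (t + 2) = (r'', c'')" by (cases "p ! (t + 2)")
      have mem: "(r, c) \<in> set p" "(r', c') \<in> set p" "(r'', c'') \<in> set p"
        unfolding u[symmetric] v[symmetric] w[symmetric] using t by auto
      obtain i j where ij: "(i, j) \<in> S" "{(r, c), (r', c')} \<in> box_edges (i, j)"
        "{(r', c'), (r'', c'')} \<in> box_edges (i, j)"
        and step: "r' = r \<and> c' = c + 1 \<and> r' = r'' + 1 \<and> c'' = c' \<or>
          r = r' + 1 \<and> c' = c \<and> r'' = r' \<and> c'' = c' + 1"
        using t(2) unfolding is_turn_def u v w right_step_def up_step_def by auto
      \<comment> \<open>Only the box with lower left corner \<open>(r, c)\<close> borders both
        edges.\<close>
      from step have "i = r \<and> j = Suc c"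
      proof
        assume "r' = r \<and> c' = c + 1 \<and> r' = r'' + 1 \<and> c'' = c'"
        then show ?thesis
          using horizontal_edge[of r c i j] vertical_edge[of r'' c' i j] ij pos[OF ij(1)]
          by (auto simp: insert_commute simp del: box_edges.simps)
      next
        assume "r = r' + 1 \<and> c' = c \<and> r'' = r' \<and> c'' = c' + 1"
        then show ?thesis
          using vertical_edge[of r' c i j] horizontal_edge[of r' c' i j] ij pos[OF ij(1)]
          by (auto simp: insert_commute simp del: box_edges.simps)
      qed
      then show "b \<in> {b \<in> S. path_corner p b}"
        using ij(1) step mem by (auto simp: b u path_corner_def)
    next
      fix b assume "b \<in> {b \<in> S. path_corner p b}"
      then obtain i j where b: "b = (i, j)" "(i, j) \<in> S" and mem: "(i, j - 1) \<in> set p"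
        "(i - 1, j) \<in> set p" "(i, j) \<in> set p \<or> (i - 1, j - 1) \<in> set p"
        by (cases b) (auto simp: path_corner_def)
      have ij: "1 \<le> i" "1 \<le> j" using pos b by auto
      obtain t where t: "t < length p" "p ! t = (i, j - 1)" using mem(1) by (auto simp: in_set_conv_nth)
      \<comment> \<open>The content of the upper right corner is 2 more than that of the lower left
        one.\<close>
      have w: "t + 2 < length p" "p ! (t + 2) = (i - 1, j)"
        using nth_eq_content[OF p t(1) mem(2), of 2] ij t(2) by auto
      from mem(3) have "is_turn S (p ! t) (p ! (t + 1)) (p ! (t + 2))"
      proof
        assume "(i, j) \<in> set p"
        then have "p ! (t + 1) = (i, j)"
          using nth_eq_content(2)[OF p t(1), of "(i, j)" 1] ij t(2) by auto
        moreover have "right_step (i, j - 1) (i, j)" "up_step (i, j) (i - 1, j)"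
          using ij by (auto simp: right_step_def up_step_def)
        moreover have "{(i, j - 1), (i, j)} \<in> box_edges (i, j)" "{(i, j), (i - 1, j)} \<in> box_edges (i, j)"
          by (auto simp: insert_commute)
        ultimately show ?thesis unfolding is_turn_def t w using b(2) by metis
      next
        assume "(i - 1, j - 1) \<in> set p"
        then have "p ! (t + 1) = (i - 1, j - 1)"
          using nth_eq_content(2)[OF p t(1), of "(i - 1, j - 1)" 1] ij t(2) by auto
        moreover have "up_step (i, j - 1) (i - 1, j - 1)" "right_step (i - 1, j - 1) (i - 1, j)"
          using ij by (auto simp: right_step_def up_step_def)
        moreover have "{(i, j - 1), (i - 1, j - 1)} \<in> box_edges (i, j)"
          "{(i - 1, j - 1), (i - 1, j)} \<in> box_edges (i, j)"
          by (auto simp: insert_commute)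
        ultimately show ?thesis unfolding is_turn_def t w using b(2) by metis
      qed
      then have "t \<in> ?A" using w by simp
      moreover have "b = ?f t" using b t ij by simp
      ultimately show "b \<in> ?f ` ?A" by blast
    qed
  qed
qed

lemma pair_pmf_of_set:
  assumes "finite A" "A \<noteq> {}" "finite B" "B \<noteq> {}"
  shows "pair_pmf (pmf_of_set A) (pmf_of_set B) = pmf_of_set (A \<times> B)"
proof (rule pmf_eqI)
  fix x :: "'a \<times> 'b"
  show "pmf (pair_pmf (pmf_of_set A) (pmf_of_set B)) x = pmf (pmf_of_set (A \<times> B)) x"
    using assms by (cases x) (simp add: pmf_pair card_cartesian_product indicator_def)
qed

lemma staircase_paths_stair_step: "p \<in> staircase_paths lam mu \<Longrightarrow> successively stair_step p"
  by (simp add: staircase_paths_def stair_step_def[abs_def])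

section \<open>The dividing path as the staircase of a profile\<close>

context connected_skew
begin

lemma stair_in_staircase_paths:
  assumes T: "increasing_on S T"
  shows "stair (col T m) k \<in> staircase_paths lam mu"
proof -
  let ?a = "col T m"
  have le: "?a (Suc i) \<le> ?a i" if "i \<le> k" for i using col_Suc_le[OF T that] .
  \<comment> \<open>A horizontal edge borders the box above it if that box is in row
    \<open>i\<close> of the shape. Otherwise the box below it lies in the shape, which for
    \<open>i \<ge> 1\<close> follows from \<open>row_overlap\<close>.\<close>
  have right: "\<exists>b\<in>S. {(i, c), (i, Suc c)} \<in> box_edges b"
    if i: "i \<le> k" "?a (Suc i) \<le> c" "c < ?a i" for i c
  proof (cases "1 \<le> i \<and> M i \<le> c")
    case True
    then have "(i, Suc c) \<in> S" using i col_bounds(2)[of i T m] by (simp add: mem_S)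
    then show ?thesis by force
  next
    case False
    have "(Suc i, Suc c) \<in> S"
    proof (cases "i = 0")
      case True
      then have "k \<noteq> 0" using i by (cases "k = 0") (auto simp: col_def part_def)
      then have "1 \<le> k" by linarith
      then show ?thesis using True i col_bounds(1)[of 1 T m] by (simp add: col_def[of _ _ 0] mem_S)
    next
      case False
      then have "c < M i" "1 \<le> i" using \<open>\<not> (1 \<le> i \<and> M i \<le> c)\<close> by auto
      moreover from this have "i \<noteq> k" using i by (auto simp: col_def)
      ultimately show ?thesis
        using i row_overlap[of i] col_bounds(1)[of "Suc i" T m] by (simp add: mem_S)
    qed
    then show ?thesis by force
  qed
  \<comment> \<open>A vertical edge borders the last small box of its row or, if no entry is small,
    the first box, which exists by \<open>row_nonempty\<close>.\<close>
  have up: "\<exists>b\<in>S. {(Suc i, ?a (Suc i)), (i, ?a (Suc i))} \<in> box_edges b" if "i < k" for i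
  proof -
    have si: "1 \<le> Suc i" "Suc i \<le> k" using that by auto
    note bd = col_bounds[OF si, of T m]
    show ?thesis
    proof (cases "M (Suc i) < ?a (Suc i)")
      case True
      then have "(Suc i, ?a (Suc i)) \<in> S" using bd si by (simp add: mem_S)
      then show ?thesis by (force simp: insert_commute)
    next
      case False
      then have "(Suc i, Suc (?a (Suc i))) \<in> S"
        using bd si row_nonempty[OF si] by (simp add: mem_S)
      then show ?thesis by (force simp: insert_commute)
    qed
  qed
  have "successively (\<lambda>u v. \<exists>b\<in>S. {u, v} \<in> box_edges b) (stair ?a k)"
    using le right up by (rule successively_stair)
  moreover have "successively (\<lambda>u v. right_step u v \<or> up_step u v) (stair ?a k)"
    by (rule successively_stair) (use le in \<open>auto simp: right_step_def up_step_def\<close>)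
  moreover have "stair ?a k \<noteq> []" "hd (stair ?a k) = (k, ?a (Suc k))" "last (stair ?a k) = (0, ?a 0)"
    using le by (intro stair_nonempty hd_stair last_stair; simp)+
  ultimately show ?thesis
    by (simp add: staircase_paths_def edge_walk_def lower_left_def upper_right_def col_def)
qed

text \<open>Among the vertices at height \<open>i\<close> or further down,
  \<open>(i, col T m i)\<close> lies farthest right, so it decides the matter for all boxes of row
  \<open>i\<close>.\<close>

lemma northwest_stair_iff:
  assumes T: "increasing_on S T" and b: "b \<in> S"
  shows "northwest (stair (col T m) k) b \<longleftrightarrow> T b < m"
proof -
  obtain i j where ij: "b = (i, j)" by (cases b)
  then have i: "1 \<le> i" "i \<le> k" using b by (auto simp: mem_S)
  have set: "set (stair (col T m) k) = {(i, c). i \<le> k \<and> col T m (Suc i) \<le> c \<and> c \<le> col T m i}"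
    using col_Suc_le[OF T] by (rule set_stair)
  have "northwest (stair (col T m) k) (i, j) \<longleftrightarrow> j \<le> col T m i"
  proof
    assume "northwest (stair (col T m) k) (i, j)"
    then obtain r c where "r \<le> k" "c \<le> col T m r" "i \<le> r" "j \<le> c"
      unfolding northwest_def set by auto
    then show "j \<le> col T m i" using col_antimono[OF T, of i r m] by simp
  next
    assume "j \<le> col T m i"
    then show "northwest (stair (col T m) k) (i, j)"
      unfolding northwest_def set using i col_Suc_le[OF T i(2), of m] by force
  qed
  then show ?thesis using less_iff_col[OF T, of i j m] b ij by simp
qed

text \<open>At a vertex where \<open>p\<close> goes right and \<open>q\<close> goes up, the boxes bordering the two edges force the
  box to the upper right of the vertex to lie in the shape; it is northwest of \<open>p\<close> but not of \<open>q\<close>.\<close>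

lemma no_divergence:
  assumes p: "p \<in> staircase_paths lam mu" and q: "q \<in> staircase_paths lam mu"
    and nw: "\<And>b. b \<in> S \<Longrightarrow> northwest p b \<Longrightarrow> northwest q b"
    and t: "Suc t < length p" "Suc t < length q" "p ! t = q ! t"
    and right: "right_step (p ! t) (p ! Suc t)" and up: "up_step (q ! t) (q ! Suc t)"
  shows False
proof -
  obtain r c where u: "p ! t = (r, c)" by (cases "p ! t")
  have v: "p ! Suc t = (r, Suc c)" using right u by (cases "p ! Suc t") (auto simp: right_step_def)
  have r: "1 \<le> r" and w: "q ! Suc t = (r - 1, c)"
    using up u t(3) by (cases "q ! Suc t"; auto simp: up_step_def)+
  have edge: "\<exists>b\<in>S. {x ! s, x ! Suc s} \<in> box_edges b"
    if "x \<in> staircase_paths lam mu" "Suc s < length x" for x s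
    using that by (auto simp: staircase_paths_def edge_walk_def successively_conv_nth)
  obtain i j where b: "(i, j) \<in> S" "{(r, c), (r, Suc c)} \<in> box_edges (i, j)"
    using edge[OF p t(1)] unfolding u v by auto
  obtain i' j' where b': "(i', j') \<in> S" "{(r, c), (r - 1, c)} \<in> box_edges (i', j')"
    using edge[OF q t(2)] unfolding t(3)[symmetric] u w by auto
  have "(r, Suc c) \<in> S \<or> (Suc r, Suc c) \<in> S"
    using horizontal_edge[OF b(2)] b(1) by (auto simp: mem_S)
  moreover have "(r, Suc c) \<in> S \<or> (r, c) \<in> S"
    using vertical_edge[of "r - 1" c i' j'] b' r by (auto simp: mem_S insert_commute)
  \<comment> \<open>Otherwise \<open>(Suc r, Suc c)\<close> and \<open>(r, c)\<close> both lie in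
    the shape, and then so does the box in question.\<close>
  ultimately have box: "(r, Suc c) \<in> S"
    using L_antimono[of r "Suc r"] by (auto simp: mem_S)
  have "p ! Suc t \<in> set p" using t(1) by (rule nth_mem)
  then have "northwest p (r, Suc c)"
    unfolding northwest_def using v by force
  then have "northwest q (r, Suc c)" using nw box by blast
  then obtain s where s: "s < length q" "r \<le> fst (q ! s)" "Suc c \<le> snd (q ! s)"
    by (auto simp: northwest_def in_set_conv_nth)
  note mono = stair_step_mono[OF staircase_paths_stair_step[OF q]]
  \<comment> \<open>Up to position \<open>t\<close> the path \<open>q\<close> stays in columns at
    most \<open>c\<close>, and later its height is at most \<open>r - 1\<close>.\<close>
  show False
  proof (cases "s \<le> t")
    case True
    moreover have "snd (q ! t) = c" using u t(3) by (metis snd_conv)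
    ultimately show False using mono(2)[of s t] s t(2) by simp
  next
    case False
    then show False using mono(1)[of "Suc t" s] s w r by simp
  qed
qed

text \<open>Two different paths first separate at a vertex where one goes right and the other up,
  which \<open>no_divergence\<close> excludes in either order.\<close>

lemma staircase_path_unique:
  assumes p: "p \<in> staircase_paths lam mu" and q: "q \<in> staircase_paths lam mu"
    and nw: "\<And>b. b \<in> S \<Longrightarrow> northwest p b \<longleftrightarrow> northwest q b"
  shows "p = q"
proof (rule ccontr)
  assume "p \<noteq> q"
  have ends: "x \<noteq> []" "hd x = lower_left lam mu" "last x = upper_right lam"
    if "x \<in> staircase_paths lam mu" for x
    using that by (auto simp: staircase_paths_def edge_walk_def)
  note ps = staircase_paths_stair_step[OF p] and qs = staircase_paths_stair_step[OF q]
  \<comment> \<open>Both paths join the same corners, and content grows by 1 per step.\<close>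
  have len: "length p = length q"
    using content_nth[OF ps, of "length p - 1"] content_nth[OF qs, of "length q - 1"]
      ends[OF p] ends[OF q] by (simp add: last_conv_nth of_nat_diff Suc_le_eq)
  with \<open>p \<noteq> q\<close> obtain t0 where t0: "t0 < length p" "p ! t0 \<noteq> q ! t0"
    by (auto simp: list_eq_iff_nth_eq)
  define t where "t = (LEAST t. p ! t \<noteq> q ! t)"
  have t: "p ! t \<noteq> q ! t" "t \<le> t0"
    unfolding t_def using t0(2) by (rule LeastI, rule Least_le)
  have "t \<noteq> 0" using t(1) ends[OF p] ends[OF q] by (metis hd_conv_nth)
  then obtain s where s: "t = Suc s" by (metis not0_implies_Suc)
  have eq: "p ! s = q ! s" using not_less_Least[of s "\<lambda>t. p ! t \<noteq> q ! t"] s t_def by auto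
  have lens: "Suc s < length p" "Suc s < length q" using t t0 s len by auto
  have "stair_step (p ! s) (p ! Suc s)" "stair_step (q ! s) (q ! Suc s)"
    using stair_step_nth[OF ps lens(1)] stair_step_nth[OF qs lens(2)] by auto
  moreover have "\<not> (right_step (p ! s) (p ! Suc s) \<and> up_step (q ! s) (q ! Suc s))"
    using no_divergence[OF p q _ lens eq] nw by blast
  moreover have "\<not> (right_step (q ! s) (q ! Suc s) \<and> up_step (p ! s) (p ! Suc s))"
    using no_divergence[OF q p _ lens(2,1) eq[symmetric]] nw by blast
  ultimately have "p ! Suc s = q ! Suc s"
    using eq by (auto simp: stair_step_def right_step_def up_step_def prod_eq_iff)
  then show False using t s by simp
qed

lemma dividing_path_eq:
  assumes T: "increasing_on S T"
  shows "dividing_path lam mu T m = stair (col T m) k"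
  unfolding dividing_path_def
proof (rule the_equality)
  show "stair (col T m) k \<in> staircase_paths lam mu \<and>
    (\<forall>b\<in>S. (T b < m \<longrightarrow> northwest (stair (col T m) k) b) \<and> (m \<le> T b \<longrightarrow> \<not> northwest (stair (col T m) k) b))"
    using stair_in_staircase_paths[OF T] northwest_stair_iff[OF T] by auto
next
  fix p
  assume p: "p \<in> staircase_paths lam mu \<and>
    (\<forall>b\<in>S. (T b < m \<longrightarrow> northwest p b) \<and> (m \<le> T b \<longrightarrow> \<not> northwest p b))"
  then have "northwest p b \<longleftrightarrow> T b < m" if "b \<in> S" for b
    using that by (meson not_le)
  then show "p = stair (col T m) k"
    using p northwest_stair_iff[OF T]
    by (intro staircase_path_unique stair_in_staircase_paths[OF T]) auto
qed

lemma col_open_gap: "col (open_gap S T m) m = col T m"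
proof
  fix i
  have "{j. (i, j) \<in> S \<and> open_gap S T m (i, j) < m} = {j. (i, j) \<in> S \<and> T (i, j) < m}"
    by (rule Collect_cong) (metis open_gap_less_iff)
  then show "col (open_gap S T m) m i = col T m i" unfolding col_def by simp
qed

text \<open>A low move is a turn at the lower right corner of \<open>b\<close>, a high move one at
  its upper left corner.\<close>

lemma movable_iff_corner:
  assumes U: "U \<in> aSYT S" and b: "b \<in> S"
  shows "movable S U b \<longleftrightarrow> path_corner (stair (ucol U) k) b"
proof -
  obtain i j where ij: "b = (i, j)" by (cases b)
  then have i: "1 \<le> i" "i \<le> k" and j: "1 \<le> j" using b by (auto simp: mem_S)
  note inc = aSYT_increasing[OF U]
  have set: "set (stair (ucol U) k) = {(i, c). i \<le> k \<and> ucol U (Suc i) \<le> c \<and> c \<le> ucol U i}"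
    using col_Suc_le[OF inc] by (rule set_stair)
  have "U b \<noteq> missing S U" using missing_notin[OF finite_S U] b by (metis imageI)
  then have "movable S U b \<longleftrightarrow> (movable S U b \<and> U b < missing S U) \<or> (movable S U b \<and> missing S U < U b)"
    by auto
  also have "\<dots> \<longleftrightarrow> (j = ucol U i \<and> ucol U (Suc i) < j) \<or> (j = Suc (ucol U i) \<and> j \<le> ucol U (i - 1))"
    using movable_low_iff[OF U, of i j] movable_high_iff[OF U, of i j] b ij by simp
  also have "\<dots> \<longleftrightarrow> path_corner (stair (ucol U) k) b"
    using i j col_Suc_le[OF inc, of i "missing S U"] col_Suc_le[OF inc, of "i - 1" "missing S U"]
    by (auto simp: path_corner_def ij set)
  finally show ?thesis .
qed

lemma turns_dividing_path:
  assumes T: "T \<in> sSYT S" and m: "m \<in> {1..card S + 1}"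
  shows "turns S (dividing_path lam mu T m) = card {b \<in> S. movable S (open_gap S T m) b}"
proof -
  let ?U = "open_gap S T m"
  have inc: "increasing_on S T" using T by (simp add: sSYT_def)
  have U: "?U \<in> aSYT S" using T by (rule open_gap_aSYT)
  have col: "col T m = ucol ?U"
    by (simp add: missing_open_gap[OF finite_S T m] col_open_gap)
  have "turns S (stair (ucol ?U) k) = card {b \<in> S. path_corner (stair (ucol ?U) k) b}"
  proof (rule turns_eq_card_corners)
    show "successively stair_step (stair (ucol ?U) k)"
      using stair_in_staircase_paths[OF aSYT_increasing[OF U]] by (rule staircase_paths_stair_step)
  qed (auto simp: mem_S)
  also have "\<dots> = card {b \<in> S. movable S ?U b}"
    using movable_iff_corner[OF U] by (metis (no_types, lifting) Collect_cong)
  finally show ?thesis unfolding dividing_path_eq[OF inc] col .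
qed

text \<open>Averaging over the pairs \<open>(T, m)\<close> is averaging over the vertices of the
  graph, and turns become movable boxes; the result is the average degree.\<close>

lemma expected_turns_eq:
  "expected_turns lam mu = 2 * real (card (low_moves S)) / ((real (card S) + 1) * real (num_SYT S))"
proof -
  let ?A = "sSYT S \<times> {1..card S + 1}"
  have fin: "finite ?A" and ne: "?A \<noteq> {}" "sSYT S \<noteq> {}" "finite (sSYT S)"
    using sSYT_nonempty[OF finite_S] finite_sSYT[OF finite_S] by auto
  have "expected_turns lam mu =
      measure_pmf.expectation (pmf_of_set ?A) (\<lambda>(T, m). real (turns S (dividing_path lam mu T m)))"
    unfolding expected_turns_def mu_BN_def
    by (simp add: pair_pmf_of_set ne case_prod_unfold)
  also have "\<dots> = (\<Sum>(T, m)\<in>?A. real (turns S (dividing_path lam mu T m))) / real (card ?A)"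
    using integral_pmf_of_set[OF ne(1) fin] by simp
  also have "(\<Sum>(T, m)\<in>?A. real (turns S (dividing_path lam mu T m)))
      = (\<Sum>(T, m)\<in>?A. real (card {b \<in> S. movable S (open_gap S T m) b}))"
    by (rule sum.cong) (auto simp: turns_dividing_path)
  also have "\<dots> = (\<Sum>U\<in>aSYT S. real (card {b \<in> S. movable S U b}))"
    using sum.reindex_bij_betw[OF bij_open_gap[OF finite_S], of "\<lambda>U. real (card {b \<in> S. movable S U b})"]
    by (simp add: case_prod_unfold)
  also have "\<dots> = 2 * real (card (low_moves S))"
    using arg_cong[OF sum_movable, of real] by simp
  finally show ?thesis by (simp add: num_SYT_def card_cartesian_product algebra_simps)
qed

end

theorem theorem2p9:
  fixes lam mu :: "nat list" and k n :: nat
  assumes "skew_pair lam mu"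
    and "skew_connected lam mu"
    and "k = length lam"
    and "n = card (skew_boxes lam mu)"
  shows "expected_turns lam mu =
           2 * (real k
                + (\<Sum>i=1..k. (real k - real i) / (real n + 1)
                      * (real (num_SYT_left lam mu i) / real (num_SYT (skew_boxes lam mu))))
                - (\<Sum>i=1..k. (real k + 1 - real i) / (real n + 1)
                      * (real (num_SYT_right lam mu i) / real (num_SYT (skew_boxes lam mu)))))
         \<and> int (card (BN_edges (skew_boxes lam mu))) =
           int k * (int n + 1) * int (num_SYT (skew_boxes lam mu))
           + (\<Sum>i=1..k. (int k - int i) * int (num_SYT_left lam mu i))
           - (\<Sum>i=1..k. (int k + 1 - int i) * int (num_SYT_right lam mu i))"
proof -
  interpret connected_skew lam mu
    by unfold_locales
      (use assms connected_row_nonempty connected_row_overlap in auto)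
  let ?f = "real (num_SYT S)" and ?n = "real n + 1"
  let ?l = "\<Sum>i=1..k. (real k - real i) * real (num_SYT_left lam mu i)"
  let ?r = "\<Sum>i=1..k. (real k + 1 - real i) * real (num_SYT_right lam mu i)"
  note low = card_low_moves[folded assms(3,4)]
  have "num_SYT S \<noteq> 0"
    using sSYT_nonempty[OF finite_S] finite_sSYT[OF finite_S] by (simp add: num_SYT_def)
  then have nz: "?f \<noteq> 0" "?n \<noteq> 0" by auto
  have "real (card (low_moves S)) = real_of_int (int (card (low_moves S)))" by simp
  also have "\<dots> = real k * ?n * ?f + ?l - ?r"
    unfolding low by simp
  finally have "expected_turns lam mu = 2 * (real k * ?n * ?f + ?l - ?r) / (?n * ?f)"
    by (simp add: expected_turns_eq assms(4))
  \<comment> \<open>Here \<open>d\<close> will be the number of vertices,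
    \<open>?n * ?f\<close>.\<close>
  moreover have "2 * (a * d + x - y) / d = 2 * (a + x / d - y / d)" if "d \<noteq> 0" for a d x y :: real
    using that by (simp add: field_simps)
  from this[of "?n * ?f" "real k" ?l ?r]
  have "2 * (real k * ?n * ?f + ?l - ?r) / (?n * ?f) = 2 * (real k + ?l / (?n * ?f) - ?r / (?n * ?f))"
    using nz by (simp only: mult.assoc mult_eq_0_iff simp_thms)
  ultimately show ?thesis
    using low card_BN_edges[OF finite_S]
    by (simp add: sum_divide_distrib)
qed

end
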